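(* Let $V$ be a countably infinite set and fix a bijection $\psi : K_V \to \mathbb{N}$. (1) The map $\|\cdot\|_{\psi,2} : \mathscr{G}(V) \to [0,1]$ (or its composition with the quotient map to the circle $S^1 = \mathbb{R}/\mathbb{Z}$) is measurable and measure-preserving, where $\mathscr{G}(V)$ carries its Haar probability measure $\mu_{\rm Haar}$ and $[0,1]$ (or $S^1$) carries Lebesgue (Haar) measure. The sets $\mathscr{G}_0(V)$ and $\mathscr{G}_1(V)$ are countable of measure zero, and outside them the map is a bijection, i.e. it restricts to a bijection from $\mathscr{G}(V) \setminus (\mathscr{G}_0(V) \cup \mathscr{G}_1(V))$ onto the complement in $[0,1]$ (or $S^1$) of the image of $\mathscr{G}_0(V) \cup \mathscr{G}_1(V)$. (2) If $f : [0,1] \to [-\infty,\infty]$ is Lebesgue integrable, then \[ \mathbb{E}_{\mu_{\rm Haar}}[f(\|\cdot\|_{\psi,2})] = \int_0^1 f(x)\,dx. \] Conversely, for every integrable $g : \mathscr{G}(V) \to [-\infty,\infty]$, \[ \mathbb{E}_{\mu_{\rm Haar}}[g] = \int_0^1 g\big( (\|\cdot\|_{\psi,2})^{-1}(x) \big)\,dx. \]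
   Context: For a set $V$ of labelled vertices, $K_V$ denotes the complete graph on $V$, identified with its edge set (the set of unordered pairs of distinct vertices). $\mathscr{G}(V)$ is the set of all graphs with vertex set $V$; each graph is identified with its edge set, so $\mathscr{G}(V) = (\mathbb{Z}/2\mathbb{Z})^{K_V}$ with the product topology, a compact Hausdorff abelian group under symmetric difference $\Delta$. $\mathscr{G}_0(V)$ is the set of graphs with finitely many edges, and $\mathscr{G}_1(V)$ is the set of co-finite graphs, i.e. complements in $K_V$ of finite graphs. $\mathbb{N} = \{1,2,3,\dots\}$. For a bijection $\psi : K_V \to \mathbb{N}$, $\|G\|_{\psi,2} := \sum_{e \in G} 2^{-\psi(e)} \in [0,1]$. $\mathbb{E}_\mu$ denotes the integral with respect to $\mu$. Measurability of the map in (1) is with respect to the Borel $\sigma$-algebras; in (2), integrability on $\mathscr{G}(V)$ is understood with respect to the completion of $\mu_{\rm Haar}$, and on $[0,1]$ with respect to Lebesgue measure. The inverse $(\|\cdot\|_{\psi,2})^{-1}$ is defined almost everywhere on $[0,1]$ as the inverse of the bijection obtained by discarding the null set of finite and/or co-finite graphs. *)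

theory Defs
  imports "HOL-Probability.Probability"
begin

definition borel_of :: "'a topology \<Rightarrow> 'a measure" where
  "borel_of T = sigma (topspace T) {U. openin T U}"

text \<open>
  Both groups used below are compact, metrizable and abelian.  On a compact metrizable space every
  Borel probability measure is regular, so regularity is not a separate requirement, and left
  and right invariance agree.
\<close>

definition haar_probability :: "'a topology \<Rightarrow> ('a \<Rightarrow> 'a \<Rightarrow> 'a) \<Rightarrow> 'a measure \<Rightarrow> bool" where
  "haar_probability T opr M \<longleftrightarrow>
     prob_space M \<and> sets M = sets (borel_of T) \<and>
     (\<forall>g\<in>topspace T. \<forall>A\<in>sets M. emeasure M (opr g ` A) = emeasure M A)"

definition haar_measure :: "'a topology \<Rightarrow> ('a \<Rightarrow> 'a \<Rightarrow> 'a) \<Rightarrow> 'a measure" where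
  "haar_measure T opr = (THE M. haar_probability T opr M)"

definition measure_preserving :: "'a measure \<Rightarrow> 'b measure \<Rightarrow> ('a \<Rightarrow> 'b) \<Rightarrow> bool" where
  "measure_preserving M N f \<longleftrightarrow>
     f \<in> M \<rightarrow>\<^sub>M N \<and> (\<forall>B\<in>sets N. emeasure M (f -` B \<inter> space M) = emeasure N B)"

text \<open>
  The Bochner integral does not cover functions with values in the extended reals, so the integral
  is defined through positive and negative parts; note that \<^const>\<open>e2ennreal\<close> maps
  negative numbers to 0.  The value of \<open>ext_integral\<close> is meaningful only for functions
  satisfying \<open>ext_integrable\<close>.
\<close>

definition ext_integrable :: "'a measure \<Rightarrow> ('a \<Rightarrow> ereal) \<Rightarrow> bool" where
  "ext_integrable M f \<longleftrightarrow> f \<in> borel_measurable M \<and> (\<integral>\<^sup>+x. e2ennreal \<bar>f x\<bar> \<partial>M) < \<infinity>"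

definition ext_integral :: "'a measure \<Rightarrow> ('a \<Rightarrow> ereal) \<Rightarrow> real" where
  "ext_integral M f =
     enn2real (\<integral>\<^sup>+x. e2ennreal (f x) \<partial>M) - enn2real (\<integral>\<^sup>+x. e2ennreal (- f x) \<partial>M)"

definition complete_edges :: "'v set \<Rightarrow> 'v set set" where
  "complete_edges V = {{u, v} | u v. u \<in> V \<and> v \<in> V \<and> u \<noteq> v}"

definition graphs :: "'v set \<Rightarrow> 'v set set set" where
  "graphs V = Pow (complete_edges V)"

definition finite_graphs :: "'v set \<Rightarrow> 'v set set set" where
  "finite_graphs V = {G \<in> graphs V. finite G}"

definition cofinite_graphs :: "'v set \<Rightarrow> 'v set set set" where
  "cofinite_graphs V = (\<lambda>G. complete_edges V - G) ` finite_graphs V"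

text \<open>
  An edge set is identified with its indicator function in the product, over all edges of the
  complete graph, of copies of the two-element discrete space.  Under this identification the
  pointwise addition modulo 2 is the symmetric difference.
\<close>

definition graph_topology :: "'v set \<Rightarrow> 'v set set topology" where
  "graph_topology V =
     pullback_topology (graphs V) (\<lambda>G. \<lambda>e\<in>complete_edges V. e \<in> G)
       (product_topology (\<lambda>_. discrete_topology (UNIV :: bool set)) (complete_edges V))"

definition graph_haar :: "'v set \<Rightarrow> 'v set set measure" where
  "graph_haar V = haar_measure (graph_topology V) (\<lambda>G H. sym_diff G H)"

definition graph_norm :: "('v set \<Rightarrow> nat) \<Rightarrow> 'v set set \<Rightarrow> real" where
  "graph_norm \<psi> G = (\<Sum>\<^sub>\<infinity>e\<in>G. 1 / 2 ^ \<psi> e)"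

definition circle_proj :: "real \<Rightarrow> real set" where
  "circle_proj x = {y. y - x \<in> \<int>}"

definition circle_topology :: "real set topology" where
  "circle_topology = topology (\<lambda>U. U \<subseteq> range circle_proj \<and> open (circle_proj -` U))"

lemma openin_circle_topology:
  "openin circle_topology U \<longleftrightarrow> U \<subseteq> range circle_proj \<and> open (circle_proj -` U)"
proof -
  have "istopology (\<lambda>U. U \<subseteq> range circle_proj \<and> open (circle_proj -` U))"
    unfolding istopology_def vimage_Int vimage_Union by (blast intro: open_Int open_UN)
  then show ?thesis
    by (simp add: circle_topology_def topology_inverse')
qed

lemma topspace_circle_topology: "topspace circle_topology = range circle_proj"
proof
  show "topspace circle_topology \<subseteq> range circle_proj"
    unfolding topspace_def openin_circle_topology by blast
  have "circle_proj -` range circle_proj = UNIV" by blast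
  then show "range circle_proj \<subseteq> topspace circle_topology"
    by (intro openin_subset) (simp add: openin_circle_topology)
qed

text \<open>The group operation is the elementwise sum of cosets from \<^theory>\<open>HOL-Library.Set_Algebras\<close>.\<close>

lemma circle_proj_add: "circle_proj x + circle_proj y = circle_proj (x + y)"
proof (intro set_eqI iffI)
  fix z assume "z \<in> circle_proj x + circle_proj y"
  then obtain a b where "z = a + b" "a - x \<in> \<int>" "b - y \<in> \<int>"
    unfolding set_plus_def circle_proj_def by blast
  then have "(a - x) + (b - y) \<in> \<int>" by (intro Ints_add)
  then show "z \<in> circle_proj (x + y)"
    using \<open>z = a + b\<close> by (simp add: circle_proj_def algebra_simps)
next
  fix z assume "z \<in> circle_proj (x + y)"
  then have "z - y \<in> circle_proj x" "y \<in> circle_proj y"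
    by (simp_all add: circle_proj_def diff_diff_add add.commute)
  then show "z \<in> circle_proj x + circle_proj y"
    using set_plus_intro[of "z - y" "circle_proj x" y "circle_proj y"] by simp
qed

definition circle_haar :: "real set measure" where
  "circle_haar = haar_measure circle_topology (+)"

end

theory Submission
  imports Defs
begin

text \<open>
  The graph whose \<open>n\<close>-th edge is present exactly if the \<open>n\<close>-th binary digit
  of \<open>x\<close> is 1 has norm \<open>x\<close>, for \<open>0 \<le> x < 1\<close>; expansions ending in
  all ones, i.e. co-finite graphs, do not occur, so this digit map inverts the norm on the other
  graphs.  The push-forward of Lebesgue measure along the digit map gives every cylinder
  \<open>{G. G \<inter> {e\<^sub>1, \<dots>, e\<^sub>n} = S}\<close> the measure \<open>2\<^sup>-\<^sup>n\<close>.  A translation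
  permutes the cylinders of a given length, so this push-forward is invariant and hence the Haar
  measure.  All integral formulas are then changes of variables along the norm or the digit map.
\<close>

subsection \<open>Binary expansions\<close>

text \<open>\<open>haar_measure\<close> is a definite description, so an invariant measure
  identifies it only once uniqueness is known. For both groups this comes from
  \<open>haar_measure_eqI\<close>, whose exchange of integrals requires the group operation to be
  jointly measurable. For graphs that rests on the cylinders being countable generators of the Borel
  sets; on the circle, on a Borel choice of representatives in [0,1). The obstacle throughout is
  that the norm is not injective: every dyadic rational in (0,1) is the norm of one finite and one
  co-finite graph, and on the circle 0 and 1 are glued as well. The collisions involve only
  countably many graphs. An inverse given by \<open>inv_into\<close> has unspecified values off the
  image of the norm, so it agrees with the digit map only almost everywhere; working in completions
  makes this enough for measurability.\<close>

definition binary_value :: "nat set \<Rightarrow> real" where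
  "binary_value A = (\<Sum>\<^sub>\<infinity>n\<in>A. 1 / 2 ^ n)"

text \<open>The \<open>n\<close>-th digit is the last bit of the integer part of
  \<open>x * 2 ^ n\<close>. On dyadic rationals this selects the terminating expansion; at
  \<open>x = 1\<close> it gives the empty set.\<close>

definition binary_digits :: "real \<Rightarrow> nat set" where
  "binary_digits x = {n. 1 \<le> n \<and> odd \<lfloor>x * 2 ^ n\<rfloor>}"

lemma binary_digits_subset: "binary_digits x \<subseteq> {1..}"
  by (auto simp: binary_digits_def)

lemma binary_digits_pred_measurable [measurable]: "Measurable.pred borel (\<lambda>x. n \<in> binary_digits x)"
  unfolding binary_digits_def by measurable

lemma has_sum_half_powers_tail: "((\<lambda>n. 1 / 2 ^ n :: real) has_sum 1 / 2 ^ N) {N<..}"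
proof -
  \<comment> \<open>The index \<open>n\<close> here stands for the exponent
    \<open>n + Suc N\<close>, the first one beyond \<open>N\<close> being
    \<open>Suc N\<close>.\<close>
  have "(\<lambda>n. (1 / 2) ^ Suc n * (1 / 2 ^ N)) sums (1 * (1 / 2 ^ N) :: real)"
    by (intro sums_mult2 power_half_series)
  then have "((\<lambda>n. (1 / 2) ^ Suc n * (1 / 2 ^ N)) has_sum (1 / 2 ^ N :: real)) UNIV"
    by (subst sums_nonneg_imp_has_sum) auto
  then have "(((\<lambda>n. 1 / 2 ^ n) \<circ> (\<lambda>k. k + Suc N)) has_sum (1 / 2 ^ N :: real)) UNIV"
    by (simp add: o_def power_add power_divide field_simps)
  then have "((\<lambda>n. 1 / 2 ^ n) has_sum (1 / 2 ^ N :: real)) ((\<lambda>k. k + Suc N) ` UNIV)"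
    by (subst has_sum_reindex) (auto simp: inj_on_def)
  moreover have "range (\<lambda>k. k + Suc N) = {N<..}"
    by (auto simp: image_iff) presburger
  ultimately show ?thesis by simp
qed

lemma summable_half_powers:
  assumes "A \<subseteq> {1..}"
  shows "(\<lambda>n. 1 / 2 ^ n :: real) summable_on A"
proof (rule summable_on_subset_banach)
  show "(\<lambda>n. 1 / 2 ^ n :: real) summable_on {0<..}"
    using has_sum_half_powers_tail[of 0] by (rule has_sum_imp_summable)
qed (use assms in auto)

lemma binary_value_nonneg: "0 \<le> binary_value A"
  unfolding binary_value_def by (rule infsum_nonneg) auto

lemma binary_value_tail_all: "binary_value {N<..} = 1 / 2 ^ N"
  unfolding binary_value_def using has_sum_half_powers_tail by (rule infsumI)

lemma binary_value_tail_le: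
  assumes "A \<subseteq> {N<..}"
  shows "binary_value A \<le> 1 / 2 ^ N"
  unfolding binary_value_tail_all[symmetric] unfolding binary_value_def
  using assms by (intro infsum_mono2 summable_half_powers) (auto simp: subset_iff)

lemma binary_value_Un:
  assumes "A \<subseteq> {1..}" "B \<subseteq> {1..}" "A \<inter> B = {}"
  shows "binary_value (A \<union> B) = binary_value A + binary_value B"
  unfolding binary_value_def using assms by (intro infsum_Un_disjoint summable_half_powers)

text \<open>A missing index \<open>m\<close> leaves room: adding it to \<open>A\<close> raises the
  value by \<open>1 / 2 ^ m\<close>, and the enlarged set still obeys the tail bound.\<close>

lemma binary_value_tail_less:
  assumes "A \<subseteq> {N<..}" "m \<notin> A" "N < m"
  shows "binary_value A < 1 / 2 ^ N"
proof -
  have "binary_value (A \<union> {m}) = binary_value A + binary_value {m}"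
    using assms by (intro binary_value_Un) (auto simp: subset_iff)
  moreover have "binary_value (A \<union> {m}) \<le> 1 / 2 ^ N"
    using assms by (intro binary_value_tail_le) auto
  moreover have "binary_value {m} = 1 / 2 ^ m"
    by (simp add: binary_value_def)
  moreover have "(0::real) < 1 / 2 ^ m" by simp
  ultimately show ?thesis by linarith
qed

text \<open>Scaling by \<open>2 ^ n\<close> turns the digits up to \<open>n\<close> into an integer;
  the later digits remain as the candidate for the fractional part.\<close>

lemma binary_value_split:
  assumes "A \<subseteq> {1..}"
  shows "binary_value A * 2 ^ n
    = of_int (\<Sum>j\<in>A \<inter> {..n}. 2 ^ (n - j)) + binary_value (A \<inter> {n<..}) * 2 ^ n"
proof -
  have "binary_value (A \<inter> {..n} \<union> A \<inter> {n<..})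
      = binary_value (A \<inter> {..n}) + binary_value (A \<inter> {n<..})"
    using assms by (intro binary_value_Un) auto
  moreover have "A \<inter> {..n} \<union> A \<inter> {n<..} = A" by auto
  moreover have "binary_value (A \<inter> {..n}) * 2 ^ n = of_int (\<Sum>j\<in>A \<inter> {..n}. 2 ^ (n - j))"
    unfolding binary_value_def of_int_sum of_int_power
    by (auto simp: sum_distrib_right power_diff[where a = "2::real"] intro!: sum.cong)
  ultimately show ?thesis by (simp add: distrib_right)
qed

text \<open>The scaled tail is a genuine fractional part, below 1, because some index beyond
  \<open>n\<close> is missing from \<open>A\<close>. For a tail of all ones it would equal 1 and the
  floor would jump.\<close>

lemma floor_binary_value:
  assumes "A \<subseteq> {1..}" "infinite ({1..} - A)"
  shows "\<lfloor>binary_value A * 2 ^ n\<rfloor> = (\<Sum>j\<in>A \<inter> {..n}. 2 ^ (n - j))"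
proof -
  obtain m where "m \<in> {1..} - A" "n < m"
    using assms(2) by (meson infinite_nat_iff_unbounded)
  then have "binary_value (A \<inter> {n<..}) < 1 / 2 ^ n"
    by (intro binary_value_tail_less[of _ _ m]) auto
  then have "binary_value (A \<inter> {n<..}) * 2 ^ n < 1"
    by (simp add: field_simps)
  moreover have "0 \<le> binary_value (A \<inter> {n<..}) * 2 ^ n"
    by (simp add: binary_value_nonneg)
  ultimately show ?thesis
    unfolding binary_value_split[OF assms(1)] by (intro floor_unique) auto
qed

text \<open>In the integer formed by the first \<open>n\<close> digits every term with
  \<open>j < n\<close> is even, so its parity is the digit at \<open>n\<close>.\<close>

lemma binary_digits_value:
  assumes "A \<subseteq> {1..}" "infinite ({1..} - A)"
  shows "binary_digits (binary_value A) = A"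
proof -
  have "odd \<lfloor>binary_value A * 2 ^ n\<rfloor> \<longleftrightarrow> n \<in> A" if "1 \<le> n" for n
  proof -
    have "A \<inter> {..n} = A \<inter> {..<n} \<union> A \<inter> {n}" by auto
    then have "(\<Sum>j\<in>A \<inter> {..n}. 2 ^ (n - j) :: int)
        = (\<Sum>j\<in>A \<inter> {..<n}. 2 ^ (n - j)) + (\<Sum>j\<in>A \<inter> {n}. 2 ^ (n - j))"
      by (simp only:) (rule sum.union_disjoint, auto)
    moreover have "even (\<Sum>j\<in>A \<inter> {..<n}. 2 ^ (n - j) :: int)"
      by (intro dvd_sum) auto
    moreover have "(\<Sum>j\<in>A \<inter> {n}. 2 ^ (n - j) :: int) = (if n \<in> A then 1 else 0)"
      by auto
    ultimately show ?thesis
      by (simp add: floor_binary_value[OF assms])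
  qed
  then show ?thesis
    using assms(1) by (auto simp: binary_digits_def)
qed

text \<open>Halving the integer part at level \<open>Suc n\<close> gives the one at level
  \<open>n\<close>, and the remainder is the new digit.\<close>

lemma floor_digits:
  assumes "0 \<le> x" "x < 1"
  shows "\<lfloor>x * 2 ^ n\<rfloor> = (\<Sum>j\<in>binary_digits x \<inter> {..n}. 2 ^ (n - j))"
proof (induction n)
  case 0
  have "binary_digits x \<inter> {..0} = {}" using binary_digits_subset by fastforce
  moreover have "\<lfloor>x\<rfloor> = 0" using assms by (intro floor_unique) auto
  ultimately show ?case by simp
next
  case (Suc n)
  let ?D = "binary_digits x"
  have "\<lfloor>x * 2 ^ n\<rfloor> = \<lfloor>x * 2 ^ Suc n\<rfloor> div 2"
    using floor_divide_real_eq_div[of 2 "x * 2 ^ Suc n"] by simp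
  then have "\<lfloor>x * 2 ^ Suc n\<rfloor> = 2 * \<lfloor>x * 2 ^ n\<rfloor> + (if Suc n \<in> ?D then 1 else 0)"
    by (auto simp: binary_digits_def elim!: oddE)
  also have "2 * \<lfloor>x * 2 ^ n\<rfloor> = (\<Sum>j\<in>?D \<inter> {..n}. 2 ^ (Suc n - j))"
    unfolding Suc.IH sum_distrib_left by (intro sum.cong) (auto simp: Suc_diff_le)
  also have "\<dots> + (if Suc n \<in> ?D then 1 else 0) = (\<Sum>j\<in>?D \<inter> {..Suc n}. 2 ^ (Suc n - j))"
    by (simp add: atMost_Suc Int_insert_right)
  finally show ?case .
qed

text \<open>Scaled by \<open>2 ^ n\<close>, both numbers lie in the closed unit interval above the
  same integer, so they differ by at most \<open>1 / 2 ^ n\<close> for every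
  \<open>n\<close>.\<close>

lemma binary_value_digits:
  assumes "0 \<le> x" "x < 1"
  shows "binary_value (binary_digits x) = x"
proof -
  let ?v = "binary_value (binary_digits x)"
  have bound: "\<bar>?v - x\<bar> \<le> 1 * (1 / 2) ^ n" for n
  proof -
    have "?v * 2 ^ n = of_int \<lfloor>x * 2 ^ n\<rfloor> + binary_value (binary_digits x \<inter> {n<..}) * 2 ^ n"
      unfolding floor_digits[OF assms] by (rule binary_value_split[OF binary_digits_subset])
    moreover have "binary_value (binary_digits x \<inter> {n<..}) * 2 ^ n \<le> 1"
      using binary_value_tail_le[of "binary_digits x \<inter> {n<..}" n] by (simp add: field_simps)
    moreover have "0 \<le> binary_value (binary_digits x \<inter> {n<..}) * 2 ^ n"
      by (simp add: binary_value_nonneg)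
    ultimately have "\<bar>?v * 2 ^ n - x * 2 ^ n\<bar> \<le> 1" by linarith
    then have "\<bar>?v - x\<bar> * 2 ^ n \<le> 1"
      by (simp add: left_diff_distrib[symmetric] abs_mult)
    then show ?thesis by (simp add: field_simps)
  qed
  have "(\<lambda>n. 1 * (1 / 2 :: real) ^ n) \<longlonglongrightarrow> 1 * 0"
    by (intro tendsto_intros LIMSEQ_power_zero) auto
  then have "\<bar>?v - x\<bar> \<le> 1 * 0"
    by (rule LIMSEQ_le_const) (use bound in auto)
  then show ?thesis by simp
qed

text \<open>If all digits beyond \<open>n\<close> were 1, the tail would contribute a full unit at
  scale \<open>2 ^ n\<close>, and \<open>x * 2 ^ n\<close> would exceed its own floor by 1.\<close>

lemma infinite_compl_binary_digits:
  assumes "0 \<le> x" "x < 1"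
  shows "infinite ({1..} - binary_digits x)"
proof
  assume "finite ({1..} - binary_digits x)"
  then obtain n where n: "\<And>m. m \<in> {1..} - binary_digits x \<Longrightarrow> m \<le> n"
    using finite_nat_set_iff_bounded_le by meson
  have "m \<in> binary_digits x" if "n < m" for m
    using n[of m] that by auto
  then have tail: "binary_digits x \<inter> {n<..} = {n<..}" by auto
  have "x * 2 ^ n = of_int \<lfloor>x * 2 ^ n\<rfloor> + 1"
    using binary_value_split[OF binary_digits_subset, of x n]
    unfolding tail binary_value_digits[OF assms] floor_digits[OF assms, symmetric]
    by (simp add: binary_value_tail_all)
  then show False by linarith
qed

lemma bij_betw_binary_value:
  "bij_betw binary_value {A. A \<subseteq> {1..} \<and> infinite ({1..} - A)} {0..<1}"
proof (rule bij_betw_byWitness[where f' = binary_digits])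
  show "binary_value ` {A. A \<subseteq> {1..} \<and> infinite ({1..} - A)} \<subseteq> {0..<1}"
  proof safe
    fix A :: "nat set" assume A: "A \<subseteq> {1..}" "infinite ({1..} - A)"
    then obtain m where "m \<in> {1..} - A" using infinite_imp_nonempty by blast
    with A have "binary_value A < 1 / 2 ^ 0"
      by (intro binary_value_tail_less[of _ _ m]) (auto simp: subset_iff Suc_le_eq)
    then show "binary_value A \<in> {0..<1}" by (simp add: binary_value_nonneg)
  qed
  show "binary_digits ` {0..<1} \<subseteq> {A. A \<subseteq> {1..} \<and> infinite ({1..} - A)}"
    using binary_digits_subset infinite_compl_binary_digits by auto
qed (use binary_digits_value binary_value_digits in auto)

text \<open>The integer part at level \<open>n\<close> determines those at all lower levels by
  integer division, hence all digits up to \<open>n\<close>. For the converse implication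
  \<open>x\<close> is compared with \<open>binary_value S\<close>, whose digit set is
  \<open>S\<close>.\<close>

lemma binary_digits_prefix_iff:
  assumes "0 \<le> x" "x < 1" and S: "S \<subseteq> {1..n}"
  shows "binary_digits x \<inter> {..n} = S \<longleftrightarrow> \<lfloor>x * 2 ^ n\<rfloor> = (\<Sum>j\<in>S. 2 ^ (n - j))"
proof
  assume "\<lfloor>x * 2 ^ n\<rfloor> = (\<Sum>j\<in>S. 2 ^ (n - j))"
  have SA: "S \<subseteq> {1..}" "infinite ({1..} - S)"
    using S finite_subset[OF S] infinite_Ici by (auto intro!: Diff_infinite_finite)
  have floor_div: "\<lfloor>y * 2 ^ j\<rfloor> = \<lfloor>y * 2 ^ n\<rfloor> div 2 ^ (n - j)" if "j \<le> n" for y :: real and j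
  proof -
    have "y * 2 ^ n / 2 ^ (n - j) = y * 2 ^ j"
      using that by (simp add: power_diff)
    then show ?thesis
      using floor_divide_real_eq_div[of "2 ^ (n - j)" "y * 2 ^ n"] by simp
  qed
  have "S \<inter> {..n} = S" using S by auto
  then have "\<lfloor>x * 2 ^ n\<rfloor> = \<lfloor>binary_value S * 2 ^ n\<rfloor>"
    using floor_binary_value[OF SA, of n] \<open>\<lfloor>x * 2 ^ n\<rfloor> = _\<close> by simp
  then have "\<lfloor>x * 2 ^ j\<rfloor> = \<lfloor>binary_value S * 2 ^ j\<rfloor>" if "j \<le> n" for j
    by (simp only: floor_div[OF that, of x] floor_div[OF that, of "binary_value S"])
  then have "binary_digits x \<inter> {..n} = binary_digits (binary_value S) \<inter> {..n}"
    by (intro set_eqI) (auto simp: binary_digits_def)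
  then show "binary_digits x \<inter> {..n} = S"
    using S by (simp add: binary_digits_value[OF SA] \<open>S \<inter> {..n} = S\<close>)
qed (simp add: floor_digits[OF assms(1,2)])

text \<open>The points with prescribed leading digits form the dyadic interval from
  \<open>k / 2 ^ n\<close> to \<open>(k + 1) / 2 ^ n\<close>, where \<open>k\<close> is the integer
  with these digits.\<close>

lemma emeasure_binary_digits_prefix:
  assumes S: "S \<subseteq> {1..n}"
  shows "emeasure lborel {x\<in>{0..<1}. binary_digits x \<inter> {..n} = S} = ennreal (1 / 2 ^ n)"
proof -
  define k :: int where "k = (\<Sum>j\<in>S. 2 ^ (n - j))"
  have fin: "finite S" using S finite_subset by blast
  have SA: "S \<subseteq> {1..}" "infinite ({1..} - S)"
    using S finite_subset[OF S] infinite_Ici by (auto intro!: Diff_infinite_finite)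
  have "S \<inter> {..n} = S" "S \<inter> {n<..} = {}" using S by auto
  then have vk: "binary_value S * 2 ^ n = of_int k"
    using binary_value_split[OF SA(1), of n] by (simp add: k_def binary_value_def)
  have "binary_value S \<in> {0..<1}"
    using bij_betw_imp_surj_on[OF bij_betw_binary_value] SA by auto
  then have "0 \<le> real_of_int k" "real_of_int k < 2 ^ n"
    unfolding vk[symmetric] by simp_all
  then have k: "0 \<le> k" "real_of_int k < real_of_int (2 ^ n)" by simp_all
  \<comment> \<open>Integrality sharpens the strict bound, so the dyadic interval does not stick out
    of [0,1).\<close>
  then have "k + 1 \<le> 2 ^ n" by (simp only: of_int_less_iff add1_zle_eq)
  then have "real_of_int (k + 1) \<le> real_of_int (2 ^ n)" by (simp only: of_int_le_iff)
  then have k': "real_of_int k + 1 \<le> 2 ^ n" by simp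
  have "{x\<in>{0..<1}. binary_digits x \<inter> {..n} = S} = {x\<in>{0..<1}. \<lfloor>x * 2 ^ n\<rfloor> = k}"
    using binary_digits_prefix_iff[OF _ _ S] unfolding k_def by auto
  also have "\<dots> = {of_int k / 2 ^ n ..< (of_int k + 1) / 2 ^ n}"
  proof -
    have iff: "\<lfloor>x * 2 ^ n\<rfloor> = k \<longleftrightarrow> of_int k / 2 ^ n \<le> x \<and> x < (of_int k + 1) / 2 ^ n" for x :: real
      by (simp add: floor_eq_iff field_simps)
    have "{x\<in>{0..<1}. a \<le> x \<and> x < b} = {a..<b}" if "0 \<le> a" "b \<le> 1" for a b :: real
      using that by auto
    from this[of "of_int k / 2 ^ n" "(of_int k + 1) / 2 ^ n"] show ?thesis
      unfolding iff using k(1) k' by simp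
  qed
  also have "emeasure lborel \<dots> = ennreal ((of_int k + 1) / 2 ^ n - of_int k / 2 ^ n)"
    by (intro emeasure_lborel_Ico) (simp add: divide_right_mono)
  also have "\<dots> = ennreal (1 / 2 ^ n)"
    by (simp add: add_divide_distrib)
  finally show ?thesis .
qed

subsection \<open>Haar measures and measure-preserving maps\<close>

lemma space_borel_of: "space (borel_of T) = topspace T"
  unfolding borel_of_def by (intro space_measure_of) (auto dest: openin_subset)

lemma sets_borel_of: "sets (borel_of T) = sigma_sets (topspace T) {U. openin T U}"
  unfolding borel_of_def by (intro sets_measure_of) (auto dest: openin_subset)

lemma haar_probability_space:
  assumes "haar_probability T opr M"
  shows "space M = topspace T"
  using assms sets_eq_imp_space_eq[of M "borel_of T"]
  by (simp add: haar_probability_def space_borel_of)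

text \<open>
  Integrating \<open>1\<^sub>A (g h)\<close> against the product of two invariant probability measures in
  the two possible orders yields the measures of \<open>A\<close> under the first and under the second one.
\<close>

lemma haar_measure_eqI:
  assumes haar: "haar_probability T opr M"
    and opr: "(\<lambda>(g, h). opr g h) \<in> borel_of T \<Otimes>\<^sub>M borel_of T \<rightarrow>\<^sub>M borel_of T"
    and comm: "\<And>g h. g \<in> topspace T \<Longrightarrow> h \<in> topspace T \<Longrightarrow> opr g h = opr h g"
    and inverse: "\<And>g. g \<in> topspace T \<Longrightarrow> \<exists>g'\<in>topspace T.
      \<forall>h\<in>topspace T. opr g (opr g' h) = h \<and> opr g' (opr g h) = h"
  shows "haar_measure T opr = M"
  unfolding haar_measure_def
proof (rule the_equality)
  show "haar_probability T opr M" by (rule haar)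
next
  fix N assume haar': "haar_probability T opr N"
  \<comment> \<open>Invariance is defined with images, integration needs preimages; the preimage
    under translation by \<open>g\<close> is the image under translation by its inverse.\<close>
  have vimage: "emeasure Q (opr g -` A \<inter> topspace T) = emeasure Q A"
    if Q: "haar_probability T opr Q" and A: "A \<in> sets Q" and g: "g \<in> topspace T" for Q A g
  proof -
    have closed: "opr a b \<in> topspace T" if "a \<in> topspace T" "b \<in> topspace T" for a b
      using measurable_space[OF opr, of "(a, b)"] that by (simp add: space_borel_of space_pair_measure)
    obtain g' where g': "g' \<in> topspace T"
      "\<And>h. h \<in> topspace T \<Longrightarrow> opr g (opr g' h) = h \<and> opr g' (opr g h) = h"
      using inverse[OF g] by blast
    have "A \<subseteq> topspace T"
      using sets.sets_into_space[OF A] haar_probability_space[OF Q] by simp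
    then have "opr g -` A \<inter> topspace T = opr g' ` A"
      using g' closed by (force simp: image_iff)
    then show ?thesis
      using Q A g'(1) by (simp add: haar_probability_def)
  qed
  have sets_M: "sets M = sets (borel_of T)" and sets_N: "sets N = sets (borel_of T)"
    using haar haar' by (simp_all add: haar_probability_def)
  have space_M: "space M = topspace T" and space_N: "space N = topspace T"
    using haar haar' by (simp_all add: haar_probability_space)
  interpret M: prob_space M using haar by (simp add: haar_probability_def)
  interpret N: prob_space N using haar' by (simp add: haar_probability_def)
  interpret pair_sigma_finite N M ..
  show "N = M"
  proof (rule measure_eqI)
    show "sets N = sets M" by (simp add: sets_M sets_N)
    fix A assume AN: "A \<in> sets N"
    then have AM: "A \<in> sets M" by (simp add: sets_M sets_N)
    have "(\<lambda>(g, h). opr g h) \<in> N \<Otimes>\<^sub>M M \<rightarrow>\<^sub>M M"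
      using opr by (simp cong: measurable_cong_sets sets_pair_measure_cong add: sets_M sets_N)
    then have meas: "(\<lambda>(g, h). indicator A (opr g h) :: ennreal) \<in> borel_measurable (N \<Otimes>\<^sub>M M)"
      using AM by (auto simp: split_def intro: measurable_compose[OF _ borel_measurable_indicator])
    have inner: "(\<integral>\<^sup>+h. indicator A (opr g h) \<partial>Q) = emeasure Q A"
      if Q: "haar_probability T opr Q" and A: "A \<in> sets Q" and g: "g \<in> topspace T" for Q g
    proof -
      have sp: "space Q = topspace T" and sets_Q: "sets Q = sets (borel_of T)"
        using haar_probability_space[OF Q] Q by (simp_all add: haar_probability_def)
      have "opr g \<in> borel_of T \<rightarrow>\<^sub>M borel_of T"
        using measurable_Pair2[OF opr, of g] g by (simp add: space_borel_of)
      then have "opr g -` A \<inter> topspace T \<in> sets Q"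
        using measurable_sets[of "opr g" "borel_of T" "borel_of T" A] A
        by (simp add: sets_Q space_borel_of)
      moreover have "(\<integral>\<^sup>+h. indicator A (opr g h) \<partial>Q)
          = (\<integral>\<^sup>+h. indicator (opr g -` A \<inter> topspace T) h \<partial>Q)"
        by (intro nn_integral_cong) (auto simp: sp indicator_def)
      ultimately show ?thesis
        by (simp add: vimage[OF Q A g])
    qed
    have "emeasure M A = (\<integral>\<^sup>+g. emeasure M A \<partial>N)"
      by (simp add: N.emeasure_space_1)
    also have "\<dots> = (\<integral>\<^sup>+g. (\<integral>\<^sup>+h. indicator A (opr g h) \<partial>M) \<partial>N)"
      by (intro nn_integral_cong) (simp add: inner[OF haar AM] space_N)
    also have "\<dots> = (\<integral>\<^sup>+h. (\<integral>\<^sup>+g. indicator A (opr g h) \<partial>N) \<partial>M)"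
      using Fubini'[OF meas] by simp
    \<comment> \<open>Commutativity makes the inner variable the right argument, so that left
      invariance of \<open>N\<close> applies.\<close>
    also have "\<dots> = (\<integral>\<^sup>+h. (\<integral>\<^sup>+g. indicator A (opr h g) \<partial>N) \<partial>M)"
      by (intro nn_integral_cong) (simp add: space_N space_M comm)
    also have "\<dots> = (\<integral>\<^sup>+h. emeasure N A \<partial>M)"
      by (intro nn_integral_cong) (simp add: inner[OF haar' AN] space_M)
    also have "\<dots> = emeasure N A"
      by (simp add: M.emeasure_space_1)
    finally show "emeasure N A = emeasure M A" ..
  qed
qed

lemma measure_preserving_iff_distr:
  "measure_preserving M N f \<longleftrightarrow> f \<in> M \<rightarrow>\<^sub>M N \<and> distr M N f = N"
proof
  assume f: "measure_preserving M N f"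
  then have "distr M N f = N"
    by (intro measure_eqI) (auto simp: measure_preserving_def emeasure_distr)
  with f show "f \<in> M \<rightarrow>\<^sub>M N \<and> distr M N f = N" by (simp add: measure_preserving_def)
next
  assume "f \<in> M \<rightarrow>\<^sub>M N \<and> distr M N f = N"
  then show "measure_preserving M N f"
    unfolding measure_preserving_def by (metis emeasure_distr)
qed

section \<open>Completions and extended-real integrals under measure-preserving maps\<close>

lemma measure_preserving_completion:
  assumes "measure_preserving M N f"
  shows "measure_preserving (completion M) (completion N) f"
proof -
  have f: "f \<in> M \<rightarrow>\<^sub>M N" and "distr M N f = N"
    using assms by (simp_all add: measure_preserving_iff_distr)
  then have distr: "distr (completion M) N f = N" by (simp add: distr_completion)
  have fc: "f \<in> completion M \<rightarrow>\<^sub>M N" using f by (rule measurable_completion)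
  \<comment> \<open>Enlarging the target to the completion requires null sets of \<open>N\<close> to
    have null preimages, which \<open>distr\<close> supplies.\<close>
  have "f \<in> completion M \<rightarrow>\<^sub>M completion N"
    using fc by (rule completion.measurable_completion2) (simp add: distr)
  moreover have "distr (completion M) (completion N) f = completion N"
    using completion.completion_distr_eq[OF fc] by (simp add: distr)
  ultimately show ?thesis by (simp add: measure_preserving_iff_distr)
qed

text \<open>Bridges \<open>lebesgue_on\<close>, a restriction of a completion, and the completion of
  the restricted measure, to which transport along maps applies. As \<open>S\<close> is measurable,
  cutting a null set down to \<open>S\<close> leaves it measurable and null.\<close>

lemma completion_restrict_space:
  assumes S: "S \<in> sets M"
  shows "completion (restrict_space M S) = restrict_space (completion M) S"
proof -
  have S': "S \<inter> space M \<in> sets M" "S \<inter> space (completion M) \<in> sets (completion M)"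
    using S by auto
  have "A \<in> sets (completion (restrict_space M S))"
    if A: "A \<in> sets (restrict_space (completion M) S)" for A
  proof -
    have "A \<in> sets (completion M)" "A \<subseteq> S"
      using A S by (auto simp: sets_restrict_space_iff)
    then obtain B N N' where B: "A = B \<union> N" "N \<subseteq> N'" "N' \<in> null_sets M" "B \<in> sets M"
      by (auto elim!: sets_completionE)
    show ?thesis
    proof (rule sets_completionI)
      show "A = B \<union> N" "N \<subseteq> N' \<inter> S" using B \<open>A \<subseteq> S\<close> by auto
      show "N' \<inter> S \<in> null_sets (restrict_space M S)" "B \<in> sets (restrict_space M S)"
        using B S \<open>A \<subseteq> S\<close> null_set_Int2[OF B(3) S]
        by (auto simp: null_sets_restrict_space sets_restrict_space_iff)
    qed
  qed
  moreover have "A \<in> sets (restrict_space (completion M) S) \<and>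
      emeasure (completion (restrict_space M S)) A = emeasure (restrict_space (completion M) S) A"
    if A: "A \<in> sets (completion (restrict_space M S))" for A
  proof -
    obtain B N N' where B: "A = B \<union> N" "N \<subseteq> N'" "N' \<in> null_sets (restrict_space M S)"
        "B \<in> sets (restrict_space M S)"
      using A by (auto elim!: sets_completionE)
    then have N': "N' \<in> null_sets M" "N' \<subseteq> S" and BM: "B \<in> sets M" "B \<subseteq> S"
      using S by (auto simp: null_sets_restrict_space sets_restrict_space_iff)
    have N: "N \<in> null_sets (completion (restrict_space M S))" "N \<in> null_sets (completion M)"
      using B N' by (auto simp: null_sets_completion_iff2)
    have AM: "A \<in> sets (completion M)" "A \<subseteq> S"
      using B BM N' N(2) by auto
    have "emeasure (completion (restrict_space M S)) A = emeasure (restrict_space M S) B"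
      unfolding B(1) using B N by (subst emeasure_Un_null_set) auto
    also have "\<dots> = emeasure (completion M) (B \<union> N)"
      using S BM N by (subst emeasure_Un_null_set) (auto simp: emeasure_restrict_space)
    also have "\<dots> = emeasure (restrict_space (completion M) S) A"
      using AM S by (simp add: emeasure_restrict_space B(1))
    finally show ?thesis using AM S by (simp add: sets_restrict_space_iff)
  qed
  ultimately show ?thesis
    by (intro measure_eqI) (blast, metis)
qed

text \<open>Preimages under \<open>f\<close> and \<open>g\<close> differ only inside a null set, all
  of whose subsets are measurable in the completion. The values of \<open>g\<close> on that null set
  are uncontrolled, hence the separate assumption on its range.\<close>

lemma measurable_completion_cong_AE:
  assumes f: "f \<in> completion M \<rightarrow>\<^sub>M N" and AE: "AE x in completion M. f x = g x"
    and g: "\<And>x. x \<in> space M \<Longrightarrow> g x \<in> space N"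
  shows "g \<in> completion M \<rightarrow>\<^sub>M N"
proof (rule measurableI)
  fix A assume A: "A \<in> sets N"
  obtain Z where Z: "{x \<in> space M. f x \<noteq> g x} \<subseteq> Z" "Z \<in> null_sets (completion M)"
    using AE by (auto simp: eventually_ae_filter)
  have "g -` A \<inter> space M = (f -` A \<inter> space M - Z) \<union> (g -` A \<inter> space M \<inter> Z)"
    using Z(1) by auto
  moreover have "g -` A \<inter> space M \<inter> Z \<in> sets (completion M)"
    using Z(2) by (intro completion.complete[of _ Z]) auto
  moreover have "f -` A \<inter> space M \<in> sets (completion M)"
    using measurable_sets[OF f A] by simp
  ultimately show "g -` A \<inter> space (completion M) \<in> sets (completion M)"
    using sets.Un sets.Diff null_setsD2[OF Z(2)] by (metis space_completion)
qed (use g in simp)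

lemma ext_integral_measure_preserving:
  assumes T: "measure_preserving M N T" and f: "ext_integrable N f"
  shows "ext_integrable M (\<lambda>x. f (T x)) \<and> ext_integral M (\<lambda>x. f (T x)) = ext_integral N f"
proof -
  have [measurable]: "T \<in> M \<rightarrow>\<^sub>M N" "f \<in> borel_measurable N" and "distr M N T = N"
    using T f by (simp_all add: measure_preserving_iff_distr ext_integrable_def)
  then have eq: "(\<integral>\<^sup>+x. h (f (T x)) \<partial>M) = (\<integral>\<^sup>+y. h (f y) \<partial>N)"
    if [measurable]: "h \<in> borel_measurable borel" for h :: "ereal \<Rightarrow> ennreal"
    using nn_integral_distr[of T M N "\<lambda>y. h (f y)"] by simp
  have "(\<integral>\<^sup>+x. e2ennreal (f (T x)) \<partial>M) = (\<integral>\<^sup>+y. e2ennreal (f y) \<partial>N)"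
    "(\<integral>\<^sup>+x. e2ennreal (- f (T x)) \<partial>M) = (\<integral>\<^sup>+y. e2ennreal (- f y) \<partial>N)"
    "(\<integral>\<^sup>+x. e2ennreal \<bar>f (T x)\<bar> \<partial>M) = (\<integral>\<^sup>+y. e2ennreal \<bar>f y\<bar> \<partial>N)"
    using eq[of e2ennreal] eq[of "\<lambda>y. e2ennreal (- y)"] eq[of "\<lambda>y. e2ennreal \<bar>y\<bar>"]
    by measurable
  moreover have "(\<lambda>x. f (T x)) \<in> borel_measurable M" by measurable
  ultimately show ?thesis
    using f by (simp add: ext_integrable_def ext_integral_def)
qed

text \<open>Serves to exchange the digit map for \<open>inv_into\<close>, about which nothing is
  known on a null set; measurability of \<open>g\<close> is therefore a conclusion.\<close>

lemma ext_integral_completion_cong_AE: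
  assumes f: "ext_integrable (completion M) f" and AE: "AE x in completion M. f x = g x"
  shows "ext_integrable (completion M) g \<and> ext_integral (completion M) f = ext_integral (completion M) g"
proof -
  have eq: "(\<integral>\<^sup>+x. h (f x) \<partial>completion M) = (\<integral>\<^sup>+x. h (g x) \<partial>completion M)" for h :: "ereal \<Rightarrow> ennreal"
    using AE by (intro nn_integral_cong_AE) (rule eventually_mono, auto)
  moreover have "g \<in> borel_measurable (completion M)"
    using f by (intro measurable_completion_cong_AE[OF _ AE]) (simp_all add: ext_integrable_def)
  ultimately show ?thesis
    using f eq[of e2ennreal] eq[of "\<lambda>y. e2ennreal (- y)"] eq[of "\<lambda>y. e2ennreal \<bar>y\<bar>"]
    by (simp add: ext_integrable_def ext_integral_def)
qed

subsection \<open>Haar measure on the circle\<close>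

lemma circle_proj_eq_iff: "circle_proj x = circle_proj y \<longleftrightarrow> x - y \<in> \<int>"
proof
  assume "circle_proj x = circle_proj y"
  moreover have "x \<in> circle_proj x" by (simp add: circle_proj_def)
  ultimately have "x \<in> circle_proj y" by simp
  then show "x - y \<in> \<int>" by (simp add: circle_proj_def)
next
  assume xy: "x - y \<in> \<int>"
  have "z - x \<in> \<int> \<longleftrightarrow> z - y \<in> \<int>" for z
    using Ints_add[OF _ xy, of "z - x"] Ints_diff[OF _ xy, of "z - y"] by auto
  then show "circle_proj x = circle_proj y" by (auto simp: circle_proj_def)
qed

lemma inj_on_circle_proj: "inj_on circle_proj {0..<1}"
proof (rule inj_onI)
  fix x y assume "x \<in> {0..<1}" "y \<in> {0..<1}" "circle_proj x = circle_proj y"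
  then have "frac x = y" by (subst frac_unique_iff) (simp add: circle_proj_eq_iff)
  with \<open>x \<in> {0..<1}\<close> show "x = y" by simp
qed

lemma circle_proj_frac: "circle_proj (frac x) = circle_proj x"
  by (simp add: circle_proj_eq_iff frac_def)

lemma circle_proj_image_unit: "circle_proj ` {0..<1} = topspace circle_topology"
proof -
  have "circle_proj x \<in> circle_proj ` {0..<1}" for x
    by (rule image_eqI[of _ _ "frac x"]) (simp_all add: circle_proj_frac frac_lt_1)
  then show ?thesis by (auto simp: topspace_circle_topology)
qed

text \<open>The section of the projection with values in [0,1). The choice is harmless since members
  of a coset differ by integers and \<open>frac\<close> ignores these.\<close>

definition circle_rep :: "real set \<Rightarrow> real" where
  "circle_rep C = frac (SOME y. y \<in> C)"

lemma circle_rep_proj: "circle_rep (circle_proj x) = frac x"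
proof -
  have "x \<in> circle_proj x" by (simp add: circle_proj_def)
  then have "(SOME y. y \<in> circle_proj x) \<in> circle_proj x" by (rule someI)
  then have "circle_proj (SOME y. y \<in> circle_proj x) = circle_proj x"
    by (simp add: circle_proj_eq_iff) (simp add: circle_proj_def)
  then show ?thesis
    unfolding circle_rep_def circle_proj_eq_iff by (metis frac_diff_zero frac_eq_0_iff)
qed

lemma circle_proj_rep: "C \<in> topspace circle_topology \<Longrightarrow> circle_proj (circle_rep C) = C"
  by (auto simp: topspace_circle_topology circle_rep_proj circle_proj_frac)

lemma measurable_circle_proj [measurable]: "circle_proj \<in> borel \<rightarrow>\<^sub>M borel_of circle_topology"
  unfolding borel_of_def
proof (rule measurable_measure_of)
  show "circle_proj -` U \<inter> space borel \<in> sets borel" if "U \<in> {U. openin circle_topology U}" for U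
    using that by (simp add: openin_circle_topology)
qed (auto simp: openin_circle_topology topspace_circle_topology)

text \<open>The section jumps only down to 0, at the integers, so its superlevel sets are open:
  everything for \<open>a < 0\<close>, and otherwise the sets lifting to the intervals from
  \<open>n + a\<close> to \<open>n + 1\<close>.\<close>

lemma measurable_circle_rep [measurable]: "circle_rep \<in> borel_measurable (borel_of circle_topology)"
  unfolding borel_measurable_iff_greater
proof
  fix a :: real
  show "{C \<in> space (borel_of circle_topology). a < circle_rep C} \<in> sets (borel_of circle_topology)"
  proof (cases "a < 0")
    case True
    have "a < circle_rep C" if "C \<in> space (borel_of circle_topology)" for C
      using that True order_less_le_trans[OF True frac_ge_0]
      by (auto simp: circle_rep_def)
    then have "{C \<in> space (borel_of circle_topology). a < circle_rep C} = space (borel_of circle_topology)"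
      by blast
    then show ?thesis by simp
  next
    case False
    let ?U = "{C \<in> range circle_proj. a < circle_rep C}"
    have "circle_proj -` ?U = (\<Union>n::int. {of_int n + a <..< of_int n + 1})"
    proof (intro set_eqI iffI)
      fix x assume "x \<in> circle_proj -` ?U"
      then have "x \<in> {of_int \<lfloor>x\<rfloor> + a <..< of_int \<lfloor>x\<rfloor> + 1}"
        using frac_lt_1[of x] by (simp add: circle_rep_proj frac_def)
      then show "x \<in> (\<Union>n::int. {of_int n + a <..< of_int n + 1})" by blast
    next
      fix x assume "x \<in> (\<Union>n::int. {of_int n + a <..< of_int n + 1})"
      then obtain n :: int where n: "of_int n + a < x" "x < of_int n + 1" by auto
      then have "\<lfloor>x\<rfloor> = n" using False by (intro floor_unique) auto
      then show "x \<in> circle_proj -` ?U"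
        using n by (simp add: circle_rep_proj frac_def)
    qed
    then have "open (circle_proj -` ?U)" by (simp add: open_UN)
    then have "openin circle_topology ?U"
      unfolding openin_circle_topology by auto
    then show ?thesis
      by (auto simp: space_borel_of topspace_circle_topology sets_borel_of)
  qed
qed

lemma emeasure_lborel_translate:
  fixes c :: real
  assumes "A \<in> sets borel"
  shows "emeasure lborel ((+) c -` A) = emeasure lborel A"
  using emeasure_distr[of "(+) c" lborel borel A] assms by (simp add: lborel_distr_plus)

text \<open>Translation moves the window to [c, c+1). Cut at the integer \<open>k + 1\<close>, with
  \<open>k\<close> the floor of \<open>c\<close>, its two pieces shift back by \<open>k\<close> and
  \<open>k + 1\<close> and together fill [0,1).\<close>

lemma emeasure_lborel_periodic:
  fixes P :: "real set" and c :: real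
  assumes P [measurable]: "P \<in> sets borel" and period: "\<And>x n. x + of_int n \<in> P \<longleftrightarrow> x \<in> P"
  shows "emeasure lborel ({0..1} \<inter> (+) c -` P) = emeasure lborel ({0..1} \<inter> P)"
proof -
  define F where "F a b = emeasure lborel ({a..<b} \<inter> P)" for a b
  have [measurable]: "(+) c -` P \<in> sets borel"
    using measurable_sets[of "(+) c" borel borel P] by simp
  \<comment> \<open>Half-open windows concatenate without overlap; the endpoint 1 is null.\<close>
  have closed: "emeasure lborel ({0..1} \<inter> Q) = emeasure lborel ({0..<1} \<inter> Q)"
    if "Q \<in> sets borel" for Q :: "real set"
  proof (rule emeasure_eq_AE)
    have "AE x in lborel. x \<noteq> (1::real)" by (rule AE_lborel_singleton)
    then show "AE x in lborel. (x \<in> {0..1} \<inter> Q) = (x \<in> {0..<1} \<inter> Q)"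
      by eventually_elim auto
  qed (use that in auto)
  have split: "F a b = F a d + F d b" if "a \<le> d" "d \<le> b" for a b d
  proof -
    have "{a..<b} \<inter> P = ({a..<d} \<inter> P) \<union> ({d..<b} \<inter> P)" using that by auto
    then show ?thesis
      unfolding F_def by (subst plus_emeasure) auto
  qed
  have shift: "F (a + of_int n) (b + of_int n) = F a b" for a b and n :: int
  proof -
    have "(+) (of_int n) -` ({a + of_int n..<b + of_int n} \<inter> P) = {a..<b} \<inter> P"
    proof (intro set_eqI)
      fix x show "x \<in> (+) (of_int n) -` ({a + of_int n..<b + of_int n} \<inter> P) \<longleftrightarrow> x \<in> {a..<b} \<inter> P"
        using period[of x n] by (simp add: add.commute)
    qed
    then show ?thesis
      unfolding F_def
      using emeasure_lborel_translate[of "{a + of_int n..<b + of_int n} \<inter> P" "of_int n"] by simp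
  qed
  define k where "k = \<lfloor>c\<rfloor>"
  have k: "0 \<le> c - of_int k" "c - of_int k \<le> 1" by (auto simp: k_def) linarith
  have "emeasure lborel ({0..1} \<inter> (+) c -` P) = emeasure lborel ((+) c -` ({c..<c + 1} \<inter> P))"
    unfolding closed[OF \<open>(+) c -` P \<in> sets borel\<close>] by (intro arg_cong[of _ _ "emeasure lborel"]) auto
  also have "\<dots> = F c (c + 1)"
    unfolding F_def by (rule emeasure_lborel_translate) simp
  also have "\<dots> = F c (of_int k + 1) + F (of_int k + 1) (c + 1)"
    using k by (intro split) auto
  also have "F c (of_int k + 1) = F (c - of_int k) 1"
    using shift[of "c - of_int k" k 1] by (simp add: add.commute)
  also have "F (of_int k + 1) (c + 1) = F 0 (c - of_int k)"
    using shift[of 0 "k + 1" "c - of_int k"] by simp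
  also have "F (c - of_int k) 1 + F 0 (c - of_int k) = F 0 1"
    using split[of 0 "c - of_int k" 1] k by (simp add: add.commute)
  also have "\<dots> = emeasure lborel ({0..1} \<inter> P)"
    by (simp add: F_def closed[OF P])
  finally show ?thesis .
qed

abbreviation (input) unit_lborel :: "real measure" where
  "unit_lborel \<equiv> restrict_space lborel {0..1}"

lemma prob_space_unit_lborel: "prob_space unit_lborel"
  by (rule prob_spaceI) (simp add: emeasure_restrict_space space_restrict_space)

lemma circle_haar_eq: "circle_haar = distr unit_lborel (borel_of circle_topology) circle_proj"
  unfolding circle_haar_def
proof (rule haar_measure_eqI)
  let ?C = "borel_of circle_topology"
  let ?M = "distr unit_lborel ?C circle_proj"
  interpret prob_space unit_lborel by (rule prob_space_unit_lborel)
  have proj [measurable]: "circle_proj \<in> unit_lborel \<rightarrow>\<^sub>M ?C"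
    by (rule measurable_restrict_space1) simp
  have add: "(+) (circle_proj y) ` A = (+) (circle_proj (- y)) -` A \<inter> topspace circle_topology"
    if "A \<subseteq> topspace circle_topology" for y A
  proof (intro set_eqI iffI)
    fix B assume "B \<in> (+) (circle_proj y) ` A"
    with that obtain x where "circle_proj x \<in> A" "B = circle_proj y + circle_proj x"
      by (auto simp: topspace_circle_topology)
    then show "B \<in> (+) (circle_proj (- y)) -` A \<inter> topspace circle_topology"
      by (simp add: circle_proj_add topspace_circle_topology)
  next
    fix B assume "B \<in> (+) (circle_proj (- y)) -` A \<inter> topspace circle_topology"
    then obtain x where "B = circle_proj x" "circle_proj (x - y) \<in> A"
      by (auto simp: topspace_circle_topology circle_proj_add)
    moreover have "circle_proj x = circle_proj y + circle_proj (x - y)"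
      by (simp add: circle_proj_add)
    ultimately show "B \<in> (+) (circle_proj y) ` A" by blast
  qed
  have emeasure_M: "emeasure ?M A = emeasure lborel ({0..1} \<inter> circle_proj -` A)"
    if A: "A \<in> sets ?C" for A
    using A by (simp add: emeasure_distr emeasure_restrict_space space_restrict_space Int_commute)
  have "emeasure ?M ((+) (circle_proj y) ` A) = emeasure ?M A" if A: "A \<in> sets ?C" for y A
  proof -
    have P: "circle_proj -` A \<in> sets borel"
      using measurable_sets[OF measurable_circle_proj A] by simp
    have sub: "A \<subseteq> topspace circle_topology"
      using sets.sets_into_space[OF A] by (simp add: space_borel_of)
    have vim: "circle_proj -` ((+) (circle_proj y) ` A) = (+) (- y) -` (circle_proj -` A)"
      unfolding add[OF sub] by (auto simp: topspace_circle_topology circle_proj_add)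
    \<comment> \<open>Measurability of the translate: a subset of the circle is the preimage under
      the section of its periodic lift, and here the lift is a translate of a Borel set of
      reals.\<close>
    have "(+) (circle_proj y) ` A = circle_rep -` (circle_proj -` ((+) (circle_proj y) ` A)) \<inter> space ?C"
      (is "?B = _")
    proof (intro set_eqI)
      have "?B \<subseteq> topspace circle_topology"
        unfolding add[OF sub] by (rule Int_lower2)
      then show "B \<in> ?B \<longleftrightarrow> B \<in> circle_rep -` (circle_proj -` ?B) \<inter> space ?C" for B
        using circle_proj_rep[of B] by (cases "B \<in> topspace circle_topology") (auto simp: space_borel_of)
    qed
    also have "\<dots> = circle_rep -` ((+) (- y) -` (circle_proj -` A)) \<inter> space ?C"
      by (simp only: vim)
    also have "\<dots> \<in> sets ?C"
      by (rule measurable_sets[OF measurable_circle_rep])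
        (use measurable_sets[of "(+) (- y)" borel borel, OF _ P] in simp)
    finally have A': "(+) (circle_proj y) ` A \<in> sets ?C" .
    have "emeasure ?M ((+) (circle_proj y) ` A)
        = emeasure lborel ({0..1} \<inter> (+) (- y) -` (circle_proj -` A))"
      unfolding emeasure_M[OF A'] vim ..
    also have "\<dots> = emeasure lborel ({0..1} \<inter> circle_proj -` A)"
    proof (rule emeasure_lborel_periodic[OF P])
      fix x :: real and n :: int
      have "circle_proj (x + of_int n) = circle_proj x" by (simp add: circle_proj_eq_iff)
      then show "x + of_int n \<in> circle_proj -` A \<longleftrightarrow> x \<in> circle_proj -` A" by simp
    qed
    finally show ?thesis by (simp add: emeasure_M[OF A])
  qed
  then show "haar_probability circle_topology (+) ?M"
    unfolding haar_probability_def topspace_circle_topology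
    using prob_space_distr[OF proj] by auto
  \<comment> \<open>Joint measurability of addition is inherited from the reals through the Borel
    section.\<close>
  have "(\<lambda>(g, h). circle_proj (circle_rep g + circle_rep h)) \<in> ?C \<Otimes>\<^sub>M ?C \<rightarrow>\<^sub>M ?C"
    by measurable
  moreover have "(case p of (g, h) \<Rightarrow> circle_proj (circle_rep g + circle_rep h)) = (case p of (g, h) \<Rightarrow> g + h)"
    if "p \<in> space (?C \<Otimes>\<^sub>M ?C)" for p
    using that by (auto simp: space_pair_measure space_borel_of circle_proj_add[symmetric] circle_proj_rep)
  ultimately show "(\<lambda>(g, h). g + h) \<in> ?C \<Otimes>\<^sub>M ?C \<rightarrow>\<^sub>M ?C"
    by (simp cong: measurable_cong)
  show "\<exists>g'\<in>topspace circle_topology. \<forall>h\<in>topspace circle_topology. g + (g' + h) = h \<and> g' + (g + h) = h"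
    if g: "g \<in> topspace circle_topology" for g
  proof -
    obtain x where "g = circle_proj x" using g by (auto simp: topspace_circle_topology)
    then show ?thesis
      by (intro bexI[of _ "circle_proj (- x)"]) (auto simp: topspace_circle_topology circle_proj_add)
  qed
qed (simp add: add.commute)

subsection \<open>Graphs and binary expansions\<close>

lemma image_Diff_separated:
  assumes "\<And>x y. x \<in> A - B \<Longrightarrow> y \<in> B \<Longrightarrow> f x \<noteq> f y"
  shows "f ` (A - B) = f ` A - f ` B"
  using assms by fastforce

locale edge_enumeration =
  fixes V :: "'v set" and \<psi> :: "'v set \<Rightarrow> nat"
  assumes enum: "bij_betw \<psi> (complete_edges V) {1..}"
begin

abbreviation edges :: "'v set set" where
  "edges \<equiv> complete_edges V"

text \<open>Since \<open>\<psi>\<close> counts from 1, these are exactly \<open>n\<close> edges,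
  which explains the measure \<open>1 / 2 ^ n\<close> of a cylinder and makes level 0
  unconstrained.\<close>

definition initial_edges :: "nat \<Rightarrow> 'v set set" where
  "initial_edges n = {e \<in> edges. \<psi> e \<le> n}"

definition cylinder :: "nat \<Rightarrow> 'v set set \<Rightarrow> 'v set set set" where
  "cylinder n S = {G \<in> graphs V. G \<inter> initial_edges n = S}"

definition digit_graph :: "real \<Rightarrow> 'v set set" where
  "digit_graph x = {e \<in> edges. \<psi> e \<in> binary_digits x}"

text \<open>The empty set is added to obtain a family closed under intersection: incompatible
  cylinders are disjoint.\<close>

definition cylinders :: "'v set set set set" where
  "cylinders = insert {} {cylinder n S | n S. S \<subseteq> initial_edges n}"

lemma inj_enum: "inj_on \<psi> edges"
  using enum by (rule bij_betw_imp_inj_on)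

lemma image_enum: "\<psi> ` edges = {1..}"
  using enum by (rule bij_betw_imp_surj_on)

lemma inj_enum_subset: "G \<subseteq> edges \<Longrightarrow> inj_on \<psi> G"
  using inj_enum by (rule inj_on_subset)

lemma mem_graphs: "G \<in> graphs V \<longleftrightarrow> G \<subseteq> edges"
  by (simp add: graphs_def)

lemma enum_image_compl: "G \<subseteq> edges \<Longrightarrow> {1..} - \<psi> ` G = \<psi> ` (edges - G)"
  using inj_on_image_set_diff[OF inj_enum, of edges G] by (simp add: image_enum)

lemma infinite_edges: "infinite edges"
  using bij_betw_finite[OF enum] infinite_Ici[of "1::nat"] by simp

lemma countable_edges: "countable edges"
  using countable_image_inj_on[OF _ inj_enum] by (simp add: image_enum)

lemma finite_initial_edges: "finite (initial_edges n)"
proof (rule finite_imageD)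
  show "finite (\<psi> ` initial_edges n)"
    by (rule finite_subset[of _ "{..n}"]) (auto simp: initial_edges_def)
qed (auto intro: inj_enum_subset simp: initial_edges_def)

lemma mem_finite_graphs: "G \<in> finite_graphs V \<longleftrightarrow> G \<subseteq> edges \<and> finite G"
  by (simp add: finite_graphs_def mem_graphs)

lemma mem_cofinite_graphs: "G \<in> cofinite_graphs V \<longleftrightarrow> G \<subseteq> edges \<and> finite (edges - G)"
proof
  assume "G \<subseteq> edges \<and> finite (edges - G)"
  moreover from this have "G = edges - (edges - G)" by blast
  ultimately show "G \<in> cofinite_graphs V"
    unfolding cofinite_graphs_def by (auto simp: mem_finite_graphs)
qed (auto simp: cofinite_graphs_def mem_finite_graphs double_diff)

lemma finite_not_cofinite: "G \<in> finite_graphs V \<Longrightarrow> G \<notin> cofinite_graphs V"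
  using infinite_edges by (auto simp: mem_finite_graphs mem_cofinite_graphs)

lemma countable_finite_graphs: "countable (finite_graphs V)"
proof -
  have "finite_graphs V = {G. finite G \<and> G \<subseteq> edges}"
    by (auto simp: mem_finite_graphs)
  then show ?thesis
    using countable_Collect_finite_subset[OF countable_edges] by simp
qed

lemma countable_cofinite_graphs: "countable (cofinite_graphs V)"
  unfolding cofinite_graphs_def by (intro countable_image countable_finite_graphs)

section \<open>The norm of a graph as a binary expansion\<close>

lemma graph_norm_eq: "G \<subseteq> edges \<Longrightarrow> graph_norm \<psi> G = binary_value (\<psi> ` G)"
  unfolding graph_norm_def binary_value_def
  by (subst infsum_reindex[OF inj_enum_subset]) (auto simp: o_def)

lemma enum_image_digit_graph: "\<psi> ` digit_graph x = binary_digits x"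
proof -
  have "\<psi> ` digit_graph x = binary_digits x \<inter> \<psi> ` edges"
    by (auto simp: digit_graph_def)
  then show ?thesis
    unfolding image_enum using binary_digits_subset by (simp add: Int_absorb2)
qed

lemma digit_graph_subset: "digit_graph x \<subseteq> edges"
  by (auto simp: digit_graph_def)

lemma graph_norm_digit_graph: "0 \<le> x \<Longrightarrow> x < 1 \<Longrightarrow> graph_norm \<psi> (digit_graph x) = x"
  by (simp add: graph_norm_eq digit_graph_subset enum_image_digit_graph binary_value_digits)

lemma infinite_compl_enum_image:
  assumes "G \<subseteq> edges" "G \<notin> cofinite_graphs V"
  shows "infinite ({1..} - \<psi> ` G)"
  unfolding enum_image_compl[OF assms(1)]
  using assms by (simp add: mem_cofinite_graphs finite_image_iff inj_enum_subset)

lemma digit_graph_norm: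
  assumes "G \<subseteq> edges" "G \<notin> cofinite_graphs V"
  shows "digit_graph (graph_norm \<psi> G) = G"
proof -
  have "\<psi> ` G \<subseteq> {1..}" using assms(1) image_enum by blast
  then have "binary_digits (graph_norm \<psi> G) = \<psi> ` G"
    using assms infinite_compl_enum_image by (simp add: graph_norm_eq binary_digits_value)
  then show ?thesis
    using assms(1) inj_enum by (auto simp: digit_graph_def inj_on_def)
qed

lemma digit_graph_not_cofinite:
  assumes "0 \<le> x" "x < 1"
  shows "digit_graph x \<notin> cofinite_graphs V"
  using infinite_compl_binary_digits[OF assms]
  unfolding enum_image_digit_graph[symmetric] enum_image_compl[OF digit_graph_subset]
  by (auto simp: mem_cofinite_graphs)

lemma graph_norm_range:
  assumes "G \<subseteq> edges"
  shows "0 \<le> graph_norm \<psi> G" "graph_norm \<psi> G \<le> 1"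
proof -
  have "\<psi> ` G \<subseteq> {0<..}" using assms image_enum by fastforce
  then show "graph_norm \<psi> G \<le> 1"
    using binary_value_tail_le[of "\<psi> ` G" 0] assms by (simp add: graph_norm_eq)
qed (simp add: assms graph_norm_eq binary_value_nonneg)

lemma bij_betw_graph_norm: "bij_betw (graph_norm \<psi>) (graphs V - cofinite_graphs V) {0..<1}"
proof (rule bij_betw_byWitness[where f' = digit_graph])
  show "graph_norm \<psi> ` (graphs V - cofinite_graphs V) \<subseteq> {0..<1}"
  proof safe
    fix G assume G: "G \<in> graphs V" "G \<notin> cofinite_graphs V"
    then have "\<psi> ` G \<subseteq> {1..}" using image_enum by (auto simp: mem_graphs)
    then have "binary_value (\<psi> ` G) \<in> {0..<1}"
      using G infinite_compl_enum_image bij_betw_imp_surj_on[OF bij_betw_binary_value]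
      by (auto simp: mem_graphs)
    then show "graph_norm \<psi> G \<in> {0..<1}"
      using G by (simp add: mem_graphs graph_norm_eq)
  qed
  show "digit_graph ` {0..<1} \<subseteq> graphs V - cofinite_graphs V"
    using digit_graph_subset digit_graph_not_cofinite by (auto simp: mem_graphs)
qed (use digit_graph_norm graph_norm_digit_graph in \<open>auto simp: mem_graphs\<close>)

section \<open>Collisions of the norm at finite and co-finite graphs\<close>

lemma graph_norm_compl:
  assumes "G \<subseteq> edges"
  shows "graph_norm \<psi> (edges - G) = 1 - graph_norm \<psi> G"
proof -
  have sub: "\<psi> ` G \<subseteq> {1..}" using assms image_enum by blast
  have "binary_value (\<psi> ` G \<union> ({1..} - \<psi> ` G)) = binary_value (\<psi> ` G) + binary_value ({1..} - \<psi> ` G)"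
    using sub by (intro binary_value_Un) auto
  moreover have "\<psi> ` G \<union> ({1..} - \<psi> ` G) = {0<..}" using sub by fastforce
  ultimately show ?thesis
    using binary_value_tail_all[of 0] assms
    by (simp add: graph_norm_eq enum_image_compl del: atLeast_Suc_greaterThan One_nat_def)
qed

lemma inj_on_graph_norm_cofinite: "inj_on (graph_norm \<psi>) (graphs V - cofinite_graphs V)"
  using bij_betw_graph_norm by (rule bij_betw_imp_inj_on)

text \<open>Complementation exchanges finite and co-finite graphs and reflects the norm at 1/2, so
  injectivity transfers from the other domain.\<close>

lemma inj_on_graph_norm_finite: "inj_on (graph_norm \<psi>) (graphs V - finite_graphs V)"
proof (rule inj_onI)
  fix G H assume G: "G \<in> graphs V - finite_graphs V" and H: "H \<in> graphs V - finite_graphs V"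
    and "graph_norm \<psi> G = graph_norm \<psi> H"
  then have "graph_norm \<psi> (edges - G) = graph_norm \<psi> (edges - H)"
    by (simp add: mem_graphs graph_norm_compl)
  moreover have "edges - F \<in> graphs V - cofinite_graphs V" if "F \<in> graphs V - finite_graphs V" for F
    using that by (auto simp: mem_graphs mem_finite_graphs mem_cofinite_graphs double_diff)
  ultimately have "edges - G = edges - H"
    using G H inj_onD[OF inj_on_graph_norm_cofinite] by blast
  then show "G = H" using G H by (auto simp: mem_graphs)
qed

abbreviation exceptional :: "'v set set set" where
  "exceptional \<equiv> finite_graphs V \<union> cofinite_graphs V"

text \<open>No graph is both finite and co-finite, so \<open>H\<close> lies in one of the two
  domains of injectivity, and \<open>G\<close> lies in both.\<close>

lemma graph_norm_not_exceptional:
  assumes "G \<in> graphs V - exceptional" "H \<in> exceptional"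
  shows "graph_norm \<psi> G \<noteq> graph_norm \<psi> H"
proof
  assume eq: "graph_norm \<psi> G = graph_norm \<psi> H"
  have "H \<in> graphs V" using assms(2) by (auto simp: mem_graphs mem_finite_graphs mem_cofinite_graphs)
  then have "G = H"
    using assms eq finite_not_cofinite[of H]
      inj_onD[OF inj_on_graph_norm_cofinite, of G H] inj_onD[OF inj_on_graph_norm_finite, of G H]
    by blast
  with assms show False by blast
qed

text \<open>The values 0 and 1 are already taken by the empty and the complete graph, both
  exceptional.\<close>

lemma graph_norm_inner:
  assumes "G \<in> graphs V - exceptional"
  shows "0 < graph_norm \<psi> G" "graph_norm \<psi> G < 1"
proof -
  have "{} \<in> exceptional" "edges \<in> exceptional"
    by (auto simp: mem_finite_graphs mem_cofinite_graphs)
  moreover have "graph_norm \<psi> {} = 0" "graph_norm \<psi> edges = 1"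
    using graph_norm_compl[of "{}"] by (simp_all add: graph_norm_def)
  ultimately have "graph_norm \<psi> G \<noteq> 0" "graph_norm \<psi> G \<noteq> 1"
    using graph_norm_not_exceptional[OF assms] by metis+
  moreover have "G \<subseteq> edges" using assms by (simp add: mem_graphs)
  ultimately show "0 < graph_norm \<psi> G" "graph_norm \<psi> G < 1"
    using graph_norm_range[of G] by simp_all
qed

lemma graph_norm_image: "graph_norm \<psi> ` graphs V = {0..1}"
proof
  show "graph_norm \<psi> ` graphs V \<subseteq> {0..1}"
    using graph_norm_range by (auto simp: mem_graphs)
  have "x \<in> graph_norm \<psi> ` graphs V" if "0 \<le> x" "x \<le> 1" for x
  proof (cases "x = 1")
    case True
    then have "x = graph_norm \<psi> edges"
      using graph_norm_compl[of "{}"] by (simp add: graph_norm_def)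
    then show ?thesis by (simp add: mem_graphs)
  next
    case False
    then show ?thesis
      using that graph_norm_digit_graph[of x] digit_graph_subset
      by (intro image_eqI[of _ _ "digit_graph x"]) (auto simp: mem_graphs)
  qed
  then show "{0..1} \<subseteq> graph_norm \<psi> ` graphs V" by auto
qed

lemma exceptional_subset: "exceptional \<subseteq> graphs V"
  by (auto simp: mem_graphs mem_finite_graphs mem_cofinite_graphs)

lemma bij_betw_graph_norm_exceptional:
  "bij_betw (graph_norm \<psi>) (graphs V - exceptional) ({0..1} - graph_norm \<psi> ` exceptional)"
proof (rule bij_betw_imageI)
  show "inj_on (graph_norm \<psi>) (graphs V - exceptional)"
    using inj_on_graph_norm_cofinite by (rule inj_on_subset) blast
  show "graph_norm \<psi> ` (graphs V - exceptional) = {0..1} - graph_norm \<psi> ` exceptional"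
    unfolding graph_norm_image[symmetric]
    by (rule image_Diff_separated) (rule graph_norm_not_exceptional)
qed

text \<open>The projection adds only the collision of 0 with 1, and norms of non-exceptional graphs
  lie strictly between.\<close>

lemma bij_betw_circle_norm_exceptional:
  "bij_betw (circle_proj \<circ> graph_norm \<psi>) (graphs V - exceptional)
    (topspace circle_topology - (circle_proj \<circ> graph_norm \<psi>) ` exceptional)"
proof (rule bij_betw_imageI)
  let ?h = "circle_proj \<circ> graph_norm \<psi>"
  have "inj_on circle_proj (graph_norm \<psi> ` (graphs V - exceptional))"
    by (rule inj_on_subset[OF inj_on_circle_proj])
      (use graph_norm_inner in \<open>force simp: less_imp_le\<close>)
  then show "inj_on ?h (graphs V - exceptional)"
    using bij_betw_imp_inj_on[OF bij_betw_graph_norm_exceptional] by (rule comp_inj_on[rotated])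
  have ne: "?h G \<noteq> ?h H" if G: "G \<in> graphs V - exceptional" and H: "H \<in> exceptional" for G H
  proof
    assume "?h G = ?h H"
    moreover have "frac (graph_norm \<psi> G) = graph_norm \<psi> G"
      using graph_norm_inner[OF G] by (simp add: frac_eq)
    ultimately have eq: "frac (graph_norm \<psi> H) = graph_norm \<psi> G"
      using circle_rep_proj by (metis comp_apply)
    have "H \<subseteq> edges" using H exceptional_subset mem_graphs by blast
    then have "0 \<le> graph_norm \<psi> H" "graph_norm \<psi> H \<le> 1" by (rule graph_norm_range)+
    then have "frac (graph_norm \<psi> H) = (if graph_norm \<psi> H = 1 then 0 else graph_norm \<psi> H)"
      by (auto simp: frac_eq)
    then show False
      using eq graph_norm_inner[OF G] graph_norm_not_exceptional[OF G H] by (auto split: if_splits)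
  qed
  \<comment> \<open>The norms of these graphs fill [0,1), which already covers the circle.\<close>
  have "topspace circle_topology = ?h ` (graphs V - cofinite_graphs V)"
    using bij_betw_imp_surj_on[OF bij_betw_graph_norm] circle_proj_image_unit
    by (metis image_comp)
  moreover have "?h ` graphs V \<subseteq> topspace circle_topology"
    by (auto simp: topspace_circle_topology)
  ultimately have "topspace circle_topology = ?h ` graphs V" by blast
  then show "?h ` (graphs V - exceptional) = topspace circle_topology - ?h ` exceptional"
    by (simp only:) (rule image_Diff_separated, rule ne)
qed

subsection \<open>Haar measure on the space of graphs\<close>

abbreviation graph_borel :: "'v set set measure" where
  "graph_borel \<equiv> borel_of (graph_topology V)"

definition digit_measure :: "'v set set measure" where
  "digit_measure = distr unit_lborel graph_borel digit_graph"

lemma topspace_graph_topology: "topspace (graph_topology V) = graphs V"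
  by (auto simp: graph_topology_def topspace_pullback_topology)

lemma space_graph_borel: "space graph_borel = graphs V"
  by (simp add: space_borel_of topspace_graph_topology)

lemma initial_edges_subset: "initial_edges n \<subseteq> edges"
  by (auto simp: initial_edges_def)

lemma cylinder_subset: "cylinder n S \<subseteq> graphs V"
  by (auto simp: cylinder_def)

lemma openin_cylinder: "openin (graph_topology V) (cylinder n S)"
proof (cases "S \<subseteq> initial_edges n")
  case True
  \<comment> \<open>Here \<open>{e \<in> S}\<close> is the singleton of a truth value: the box fixes
    the coordinates of the initial edges and leaves the others free.\<close>
  let ?B = "\<lambda>e. if e \<in> initial_edges n then {e \<in> S} else (UNIV :: bool set)"
  have "finite {e \<in> edges. ?B e \<noteq> UNIV}"
    using finite_initial_edges by (rule rev_finite_subset) auto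
  then have "openin (product_topology (\<lambda>_. discrete_topology UNIV) edges) (Pi\<^sub>E edges ?B)"
    by (simp add: openin_PiE_gen)
  moreover have "cylinder n S = (\<lambda>G. \<lambda>e\<in>edges. e \<in> G) -` Pi\<^sub>E edges ?B \<inter> graphs V"
    using True initial_edges_subset by (fastforce simp: cylinder_def PiE_iff split: if_splits)
  ultimately show ?thesis
    unfolding graph_topology_def openin_pullback_topology by blast
next
  case False
  then have "cylinder n S = {}" by (auto simp: cylinder_def)
  then show ?thesis by simp
qed

text \<open>A basic open box constrains finitely many edges; their indices have a common bound
  \<open>n\<close>, so the prefix of length \<open>n\<close> decides membership.\<close>

lemma openin_graph_topologyD:
  assumes "openin (graph_topology V) U" "G \<in> U"
  shows "\<exists>n. cylinder n (G \<inter> initial_edges n) \<subseteq> U"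
proof -
  let ?i = "\<lambda>G. \<lambda>e\<in>edges. e \<in> G"
  obtain W where W: "openin (product_topology (\<lambda>_. discrete_topology (UNIV :: bool set)) edges) W"
    "U = ?i -` W \<inter> graphs V"
    using assms(1) unfolding graph_topology_def openin_pullback_topology by blast
  then have "?i G \<in> W" using assms(2) by blast
  then obtain X where X: "finite {e \<in> edges. X e \<noteq> (UNIV :: bool set)}" "?i G \<in> Pi\<^sub>E edges X" "Pi\<^sub>E edges X \<subseteq> W"
    using W(1) unfolding openin_product_topology_alt topspace_discrete_topology by meson
  obtain n where n: "\<psi> ` {e \<in> edges. X e \<noteq> UNIV} \<subseteq> {..n}"
    using X(1) finite_nat_iff_bounded_le by blast
  have "H \<in> U" if H: "H \<in> cylinder n (G \<inter> initial_edges n)" for H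
  proof -
    have "?i H e \<in> X e" if e: "e \<in> edges" for e
    proof (cases "X e = UNIV")
      case False
      then have "e \<in> initial_edges n" using n e by (auto simp: initial_edges_def)
      then have "e \<in> H \<longleftrightarrow> e \<in> G" using H by (auto simp: cylinder_def)
      moreover have "?i G e \<in> X e" using X(2) e by (rule PiE_mem)
      ultimately show ?thesis using e by simp
    qed simp
    then have "?i H \<in> Pi\<^sub>E edges X" by simp
    then have "?i H \<in> W" using X(3) by (rule rev_subsetD)
    moreover have "H \<in> graphs V" using H cylinder_subset by blast
    ultimately show ?thesis by (simp add: W(2))
  qed
  then show ?thesis by blast
qed

section \<open>Cylinders generate the Borel sets\<close>

lemma countable_cylinders: "countable cylinders"
proof -
  have "cylinders = insert {} (\<Union>n. cylinder n ` Pow (initial_edges n))"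
    by (auto simp: cylinders_def)
  then show ?thesis
    by (simp add: countable_finite finite_initial_edges)
qed

lemma cylinders_Pow: "cylinders \<subseteq> Pow (graphs V)"
  using cylinder_subset by (auto simp: cylinders_def)

text \<open>Cylinders form a tree: one of greater length is contained in or disjoint from one of
  smaller length.\<close>

lemma Int_stable_cylinders: "Int_stable cylinders"
proof -
  have Int: "cylinder n S \<inter> cylinder m R \<in> cylinders"
    if "n \<le> m" "S \<subseteq> initial_edges n" "R \<subseteq> initial_edges m" for n m S R
  proof -
    have mono: "initial_edges n \<subseteq> initial_edges m"
      using \<open>n \<le> m\<close> by (auto simp: initial_edges_def)
    show ?thesis
    proof (cases "R \<inter> initial_edges n = S")
      case True
      then have "cylinder n S \<inter> cylinder m R = cylinder m R"
        using mono by (auto simp: cylinder_def)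
      then show ?thesis using that by (auto simp: cylinders_def)
    next
      case False
      then have "cylinder n S \<inter> cylinder m R = {}"
        using mono by (auto simp: cylinder_def)
      then show ?thesis by (simp add: cylinders_def)
    qed
  qed
  show ?thesis
  proof (rule Int_stableI)
    fix A B assume AB: "A \<in> cylinders" "B \<in> cylinders"
    show "A \<inter> B \<in> cylinders"
    proof (cases "A = {} \<or> B = {}")
      case True
      then show ?thesis by (auto simp: cylinders_def)
    next
      case False
      with AB obtain n S m R where "A = cylinder n S" "S \<subseteq> initial_edges n"
        "B = cylinder m R" "R \<subseteq> initial_edges m"
        by (auto simp: cylinders_def)
      then show ?thesis
        using Int[of n m S R] Int[of m n R S] by (cases "n \<le> m") (auto simp: Int_commute)
    qed
  qed
qed

text \<open>Such a set is the union of the cylinders inside it, and there are only countably many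
  cylinders in all. Applied to open sets and to superlevel sets of the norm.\<close>

lemma locally_cylindrical_sigma_sets:
  assumes "\<And>G. G \<in> U \<Longrightarrow> \<exists>n. cylinder n (G \<inter> initial_edges n) \<subseteq> U" and "U \<subseteq> graphs V"
  shows "U \<in> sigma_sets (graphs V) cylinders"
proof -
  let ?C = "{C \<in> cylinders. C \<subseteq> U}"
  have "U = \<Union> ?C"
  proof (intro equalityI subsetI)
    fix G assume G: "G \<in> U"
    obtain n where n: "cylinder n (G \<inter> initial_edges n) \<subseteq> U" using assms(1)[OF G] by blast
    have "G \<in> cylinder n (G \<inter> initial_edges n)"
      using G assms(2) by (auto simp: cylinder_def)
    moreover have "cylinder n (G \<inter> initial_edges n) \<in> cylinders"
      by (auto simp: cylinders_def)
    ultimately show "G \<in> \<Union> ?C" using n by blast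
  qed auto
  moreover have "countable ?C"
    using countable_cylinders by (rule countable_subset[rotated]) auto
  then have "\<Union> ?C \<in> sigma_sets (graphs V) cylinders"
    by (rule sigma_sets_UNION) auto
  ultimately show ?thesis by simp
qed

lemma sets_graph_borel: "sets graph_borel = sigma_sets (graphs V) cylinders"
  unfolding sets_borel_of topspace_graph_topology
proof (rule sigma_sets_eqI)
  fix U assume "U \<in> {U. openin (graph_topology V) U}"
  then show "U \<in> sigma_sets (graphs V) cylinders"
    using openin_graph_topologyD openin_subset[of "graph_topology V" U] topspace_graph_topology
    by (intro locally_cylindrical_sigma_sets) auto
next
  fix C assume "C \<in> cylinders"
  then have "openin (graph_topology V) C" by (auto simp: cylinders_def openin_cylinder)
  then show "C \<in> sigma_sets (graphs V) {U. openin (graph_topology V) U}" by blast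
qed

lemma cylinder_sets: "cylinder n S \<in> sets graph_borel"
  unfolding sets_borel_of using openin_cylinder by blast

lemma measurable_into_graph_borel:
  assumes "\<And>x. x \<in> space M \<Longrightarrow> f x \<in> graphs V"
    and "\<And>n S. S \<subseteq> initial_edges n \<Longrightarrow> f -` cylinder n S \<inter> space M \<in> sets M"
  shows "f \<in> M \<rightarrow>\<^sub>M graph_borel"
  by (rule measurable_sigma_sets[OF sets_graph_borel cylinders_Pow])
    (use assms in \<open>auto simp: cylinders_def\<close>)

lemma digit_graph_cylinder_iff:
  assumes "S \<subseteq> initial_edges n"
  shows "digit_graph x \<in> cylinder n S \<longleftrightarrow> binary_digits x \<inter> {..n} = \<psi> ` S"
proof -
  have "\<psi> ` (digit_graph x \<inter> initial_edges n) = \<psi> ` digit_graph x \<inter> {..n}"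
    by (auto simp: digit_graph_def initial_edges_def)
  moreover have "digit_graph x \<inter> initial_edges n = S
      \<longleftrightarrow> \<psi> ` (digit_graph x \<inter> initial_edges n) = \<psi> ` S"
    using assms initial_edges_subset
    by (subst inj_on_image_eq_iff[OF inj_enum]) blast+
  ultimately show ?thesis
    by (simp add: cylinder_def mem_graphs digit_graph_subset enum_image_digit_graph)
qed

lemma measurable_digit_graph [measurable]: "digit_graph \<in> unit_lborel \<rightarrow>\<^sub>M graph_borel"
proof (rule measurable_restrict_space1, rule measurable_into_graph_borel)
  fix n S assume S: "S \<subseteq> initial_edges n"
  have "{x \<in> space lborel. \<forall>j\<in>{..n}. j \<in> binary_digits x \<longleftrightarrow> j \<in> \<psi> ` S} \<in> sets lborel"
    by measurable
  moreover have "\<psi> ` S \<subseteq> {..n}" using S by (auto simp: initial_edges_def)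
  then have "digit_graph -` cylinder n S \<inter> space lborel
      = {x \<in> space lborel. \<forall>j\<in>{..n}. j \<in> binary_digits x \<longleftrightarrow> j \<in> \<psi> ` S}"
    by (auto simp: digit_graph_cylinder_iff[OF S] set_eq_iff)
  ultimately show "digit_graph -` cylinder n S \<inter> space lborel \<in> sets lborel" by simp
qed (simp add: mem_graphs digit_graph_subset)

lemma prob_space_digit_measure: "prob_space digit_measure"
  unfolding digit_measure_def
  by (rule prob_space.prob_space_distr[OF prob_space_unit_lborel measurable_digit_graph])

lemma sets_digit_measure [simp, measurable_cong]: "sets digit_measure = sets graph_borel"
  by (simp add: digit_measure_def)

lemma space_digit_measure [simp]: "space digit_measure = graphs V"
  by (simp add: digit_measure_def space_graph_borel)

lemma emeasure_digit_measure_cylinder: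
  assumes S: "S \<subseteq> initial_edges n"
  shows "emeasure digit_measure (cylinder n S) = ennreal (1 / 2 ^ n)"
proof -
  have sub: "\<psi> ` S \<subseteq> {1..n}"
  proof -
    have "\<psi> ` S \<subseteq> \<psi> ` edges" using S initial_edges_subset by blast
    moreover have "\<psi> ` S \<subseteq> {..n}" using S by (auto simp: initial_edges_def)
    ultimately show ?thesis unfolding image_enum by fastforce
  qed
  let ?A = "digit_graph -` cylinder n S \<inter> space unit_lborel"
  have A: "?A \<in> sets unit_lborel"
    by (rule measurable_sets[OF measurable_digit_graph cylinder_sets])
  then have A': "?A \<in> sets lborel" by (simp add: sets_restrict_space_iff)
  have "emeasure digit_measure (cylinder n S) = emeasure lborel ?A"
    using A by (simp add: digit_measure_def emeasure_distr cylinder_sets emeasure_restrict_space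
        space_restrict_space)
  also have "\<dots> = emeasure lborel (?A \<inter> {0..<1})"
  proof (rule emeasure_eq_AE)
    have "AE x in lborel. x \<noteq> (1::real)" by (rule AE_lborel_singleton)
    then show "AE x in lborel. (x \<in> ?A) = (x \<in> ?A \<inter> {0..<1})"
      by eventually_elim (auto simp: space_restrict_space)
  qed (use A' in auto)
  also have "?A \<inter> {0..<1} = {x\<in>{0..<1}. binary_digits x \<inter> {..n} = \<psi> ` S}"
    unfolding vimage_def digit_graph_cylinder_iff[OF S] space_restrict_space by fastforce
  also have "emeasure lborel \<dots> = ennreal (1 / 2 ^ n)"
    by (rule emeasure_binary_digits_prefix[OF sub])
  finally show ?thesis .
qed

text \<open>Symmetric difference acts edge by edge, so it commutes with taking prefixes, and the
  equation for the prefix of \<open>H\<close> is solved by cancelling that of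
  \<open>G\<close>.\<close>

lemma sym_diff_cylinder_iff:
  assumes "G \<subseteq> edges" "H \<subseteq> edges"
  shows "sym_diff G H \<in> cylinder n S \<longleftrightarrow>
    S \<subseteq> initial_edges n \<and> H \<in> cylinder n (sym_diff S (G \<inter> initial_edges n))"
  using assms by (fastforce simp: cylinder_def mem_graphs)

text \<open>Splitting by the finitely many prefixes \<open>R\<close> of the first graph makes the
  preimage of a cylinder a finite union of rectangles.\<close>

lemma measurable_sym_diff: "(\<lambda>(G, H). sym_diff G H) \<in> graph_borel \<Otimes>\<^sub>M graph_borel \<rightarrow>\<^sub>M graph_borel"
proof (rule measurable_into_graph_borel)
  fix n S assume S: "S \<subseteq> initial_edges n"
  have "(\<lambda>(G, H). sym_diff G H) -` cylinder n S \<inter> space (graph_borel \<Otimes>\<^sub>M graph_borel)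
      = (\<Union>R\<in>Pow (initial_edges n). cylinder n R \<times> cylinder n (sym_diff S R))"
    (is "?L = ?R")
  proof (intro set_eqI)
    fix p :: "'v set set \<times> 'v set set"
    obtain G H where p: "p = (G, H)" by (cases p)
    show "p \<in> ?L \<longleftrightarrow> p \<in> ?R"
    proof
      assume "p \<in> ?L"
      then have "G \<in> graphs V" "H \<in> graphs V" "sym_diff G H \<in> cylinder n S"
        by (auto simp: p space_pair_measure space_graph_borel)
      then have "G \<in> cylinder n (G \<inter> initial_edges n)"
        "H \<in> cylinder n (sym_diff S (G \<inter> initial_edges n))"
        using sym_diff_cylinder_iff[of G H n S] by (simp_all add: mem_graphs cylinder_def[of n "G \<inter> _"])
      then show "p \<in> ?R" by (auto simp: p)
    next
      assume "p \<in> ?R"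
      then obtain R where "G \<in> cylinder n R" "H \<in> cylinder n (sym_diff S R)"
        by (auto simp: p)
      moreover from this have "G \<subseteq> edges" "H \<subseteq> edges" "R = G \<inter> initial_edges n"
        by (auto simp: cylinder_def mem_graphs)
      ultimately show "p \<in> ?L"
        using S sym_diff_cylinder_iff[of G H n S]
        by (simp add: p space_pair_measure space_graph_borel mem_graphs)
    qed
  qed
  also have "\<dots> \<in> sets (graph_borel \<Otimes>\<^sub>M graph_borel)"
    using finite_initial_edges by (intro sets.finite_UN) (auto intro: cylinder_sets)
  finally show "(\<lambda>(G, H). sym_diff G H) -` cylinder n S \<inter> space (graph_borel \<Otimes>\<^sub>M graph_borel)
    \<in> sets (graph_borel \<Otimes>\<^sub>M graph_borel)" .
qed (auto simp: space_pair_measure space_graph_borel mem_graphs)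

lemma sym_diff_cancel: "sym_diff G (sym_diff G H) = H"
  by blast

lemma measurable_sym_diff_left:
  assumes "G \<in> graphs V"
  shows "sym_diff G \<in> graph_borel \<rightarrow>\<^sub>M graph_borel"
  using measurable_Pair2[OF measurable_sym_diff, of G] assms by (simp add: space_graph_borel)

lemma distr_sym_diff:
  assumes G: "G \<in> graphs V"
  shows "distr digit_measure graph_borel (sym_diff G) = digit_measure"
proof (rule measure_eqI_generator_eq[OF Int_stable_cylinders cylinders_Pow])
  have meas: "sym_diff G \<in> digit_measure \<rightarrow>\<^sub>M graph_borel"
    using measurable_sym_diff_left[OF G] by simp
  fix C assume "C \<in> cylinders"
  then consider "C = {}" | n S where "C = cylinder n S" "S \<subseteq> initial_edges n"
    by (auto simp: cylinders_def)
  then show "emeasure (distr digit_measure graph_borel (sym_diff G)) C = emeasure digit_measure C"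
  proof cases
    case (2 n S)
    have "sym_diff G -` cylinder n S \<inter> graphs V = cylinder n (sym_diff S (G \<inter> initial_edges n))"
    proof (intro set_eqI)
      fix H
      show "H \<in> sym_diff G -` cylinder n S \<inter> graphs V
          \<longleftrightarrow> H \<in> cylinder n (sym_diff S (G \<inter> initial_edges n))"
        using sym_diff_cylinder_iff[of G H n S] G 2(2)
          subsetD[OF cylinder_subset[of n "sym_diff S (G \<inter> initial_edges n)"], of H]
        by (cases "H \<in> graphs V") (auto simp: mem_graphs)
    qed
    moreover have "sym_diff S (G \<inter> initial_edges n) \<subseteq> initial_edges n"
      using 2(2) by blast
    ultimately show ?thesis
      using 2 by (simp add: emeasure_distr[OF meas] cylinder_sets emeasure_digit_measure_cylinder)
  qed simp
next
  \<comment> \<open>No edge has index 0, so the whole space is itself a cylinder, as the uniqueness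
    theorem for measures on a generator requires.\<close>
  have "cylinder 0 {} = graphs V"
    using image_enum by (fastforce simp: cylinder_def initial_edges_def)
  then show "range (\<lambda>_. graphs V) \<subseteq> cylinders" by (auto simp: cylinders_def)
  show "(\<Union>i::nat. graphs V) = graphs V" by simp
  interpret D: prob_space digit_measure by (rule prob_space_digit_measure)
  interpret D': prob_space "distr digit_measure graph_borel (sym_diff G)"
    using measurable_sym_diff_left[OF G] by (intro D.prob_space_distr) simp
  show "emeasure (distr digit_measure graph_borel (sym_diff G)) (graphs V) \<noteq> \<infinity>" for i :: nat
    by simp
qed (simp_all add: sets_graph_borel)

lemma graph_haar_eq: "graph_haar V = digit_measure"
  unfolding graph_haar_def
proof (rule haar_measure_eqI)
  show "haar_probability (graph_topology V) sym_diff digit_measure"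
    unfolding haar_probability_def topspace_graph_topology
  proof (intro conjI ballI)
    fix G A assume G: "G \<in> graphs V" and A: "A \<in> sets digit_measure"
    then have "A \<subseteq> graphs V" using sets.sets_into_space[OF A] by simp
    then have "sym_diff G -` A \<inter> graphs V = sym_diff G ` A"
    proof (intro equalityI subsetI)
      fix H assume "H \<in> sym_diff G -` A \<inter> graphs V"
      then show "H \<in> sym_diff G ` A"
        by (intro image_eqI[of _ _ "sym_diff G H"]) (auto simp only: sym_diff_cancel)
    next
      fix H assume "H \<in> sym_diff G ` A"
      then obtain F where F: "F \<in> A" "H = sym_diff G F" by (rule imageE)
      with \<open>A \<subseteq> graphs V\<close> have "F \<subseteq> edges" by (auto simp only: mem_graphs subset_iff)
      then have "H \<subseteq> edges" using G F(2) by (auto simp: mem_graphs)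
      moreover have "sym_diff G H \<in> A" using F by (simp only: sym_diff_cancel)
      ultimately show "H \<in> sym_diff G -` A \<inter> graphs V" by (simp only: mem_graphs vimage_def Int_iff mem_Collect_eq)
    qed
    then show "emeasure digit_measure (sym_diff G ` A) = emeasure digit_measure A"
      using emeasure_distr[of "sym_diff G" digit_measure graph_borel A] measurable_sym_diff_left[OF G] A
      by (simp add: distr_sym_diff[OF G])
  qed (simp_all add: prob_space_digit_measure)
  show "\<exists>G'\<in>topspace (graph_topology V). \<forall>H\<in>topspace (graph_topology V).
      sym_diff G (sym_diff G' H) = H \<and> sym_diff G' (sym_diff G H) = H"
    if "G \<in> topspace (graph_topology V)" for G
    \<comment> \<open>Every graph is its own inverse.\<close>
    using that by (intro bexI[of _ G]) auto
qed (use measurable_sym_diff in auto)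

text \<open>If the norm of \<open>G\<close> exceeds \<open>a\<close>, so does the contribution of a
  long enough prefix, and graphs sharing this prefix have at least that norm. Hence superlevel sets
  are locally cylindrical.\<close>

lemma measurable_graph_norm: "graph_norm \<psi> \<in> borel_measurable graph_borel"
  unfolding borel_measurable_iff_greater
proof
  fix a :: real
  let ?U = "{G \<in> graphs V. a < graph_norm \<psi> G}"
  have "\<exists>n. cylinder n (G \<inter> initial_edges n) \<subseteq> ?U" if G: "G \<in> ?U" for G
  proof -
    have split: "graph_norm \<psi> F = binary_value (\<psi> ` (F \<inter> initial_edges n)) + binary_value (\<psi> ` (F - initial_edges n))"
      if F: "F \<in> graphs V" for F n
    proof -
      have "\<psi> ` F = \<psi> ` (F \<inter> initial_edges n) \<union> \<psi> ` (F - initial_edges n)" by blast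
      then have "graph_norm \<psi> F = binary_value (\<psi> ` (F \<inter> initial_edges n) \<union> \<psi> ` (F - initial_edges n))"
        using F by (simp add: mem_graphs graph_norm_eq)
      also have "\<dots> = binary_value (\<psi> ` (F \<inter> initial_edges n)) + binary_value (\<psi> ` (F - initial_edges n))"
        using F image_enum by (intro binary_value_Un) (auto simp: mem_graphs initial_edges_def)
      finally show ?thesis .
    qed
    \<comment> \<open>The edges beyond \<open>n\<close> contribute at most \<open>1 / 2 ^ n\<close>,
      less than the gap.\<close>
    obtain n where n: "(1 / 2) ^ n < graph_norm \<psi> G - a"
      using real_arch_pow_inv[of "graph_norm \<psi> G - a" "1 / 2"] G by auto
    have "binary_value (\<psi> ` (G - initial_edges n)) \<le> 1 / 2 ^ n"
      using G by (intro binary_value_tail_le) (auto simp: initial_edges_def mem_graphs)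
    then have "a < binary_value (\<psi> ` (G \<inter> initial_edges n))"
      using n G split[of G n] by (simp add: power_divide)
    then have "H \<in> ?U" if "H \<in> cylinder n (G \<inter> initial_edges n)" for H
      using that split[of H n] binary_value_nonneg[of "\<psi> ` (H - initial_edges n)"]
      by (simp add: cylinder_def)
    then show ?thesis by blast
  qed
  then have "?U \<in> sets graph_borel"
    unfolding sets_graph_borel by (rule locally_cylindrical_sigma_sets) auto
  then show "{G \<in> space graph_borel. a < graph_norm \<psi> G} \<in> sets graph_borel"
    by (simp add: space_graph_borel)
qed

section \<open>Transfer between graphs and the unit interval\<close>

lemma measure_preserving_digit_graph: "measure_preserving unit_lborel (graph_haar V) digit_graph"
  unfolding measure_preserving_iff_distr graph_haar_eq digit_measure_def
  by (intro conjI distr_cong) (simp_all add: measurable_digit_graph)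

text \<open>The Haar measure is the push-forward along the digit map, which the norm undoes at every
  point except 1; pushing forward again returns Lebesgue measure.\<close>

lemma measure_preserving_graph_norm: "measure_preserving (graph_haar V) unit_lborel (graph_norm \<psi>)"
proof -
  have meas: "graph_norm \<psi> \<in> graph_borel \<rightarrow>\<^sub>M unit_lborel"
    using measurable_graph_norm graph_norm_range
    by (intro measurable_restrict_space2) (auto simp: space_graph_borel mem_graphs)
  have "AE x in lborel. x \<noteq> (1::real)" by (rule AE_lborel_singleton)
  then have AE: "AE x in unit_lborel. graph_norm \<psi> (digit_graph x) = x"
    by (auto simp: AE_restrict_space_iff elim!: eventually_mono intro!: graph_norm_digit_graph)
  have "distr digit_measure unit_lborel (graph_norm \<psi>)
      = distr unit_lborel unit_lborel (graph_norm \<psi> \<circ> digit_graph)"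
    unfolding digit_measure_def by (rule distr_distr[OF meas measurable_digit_graph])
  also have "\<dots> = distr unit_lborel unit_lborel (\<lambda>x. x)"
    using AE measurable_comp[OF measurable_digit_graph meas]
    by (intro distr_cong_AE) (simp_all add: o_def)
  also have "\<dots> = unit_lborel" by (rule distr_id)
  finally show ?thesis
    using meas by (simp add: measure_preserving_iff_distr graph_haar_eq)
qed

lemma measure_preserving_circle_norm:
  "measure_preserving (graph_haar V) circle_haar (circle_proj \<circ> graph_norm \<psi>)"
proof -
  have norm: "graph_norm \<psi> \<in> graph_haar V \<rightarrow>\<^sub>M unit_lborel"
    "distr (graph_haar V) unit_lborel (graph_norm \<psi>) = unit_lborel"
    using measure_preserving_graph_norm by (simp_all add: measure_preserving_iff_distr)
  have proj: "circle_proj \<in> unit_lborel \<rightarrow>\<^sub>M borel_of circle_topology"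
    by (rule measurable_restrict_space1) simp
  have "distr (graph_haar V) (borel_of circle_topology) (circle_proj \<circ> graph_norm \<psi>) = circle_haar"
    using distr_distr[OF proj norm(1)] norm(2) by (simp add: circle_haar_eq)
  moreover have "distr (graph_haar V) circle_haar (circle_proj \<circ> graph_norm \<psi>)
      = distr (graph_haar V) (borel_of circle_topology) (circle_proj \<circ> graph_norm \<psi>)"
    by (intro distr_cong) (simp_all add: circle_haar_eq)
  moreover have "circle_proj \<circ> graph_norm \<psi> \<in> graph_haar V \<rightarrow>\<^sub>M circle_haar"
    using measurable_comp[OF norm(1) proj] by (simp add: circle_haar_eq)
  ultimately show ?thesis by (simp add: measure_preserving_iff_distr)
qed

text \<open>A single graph lies in a fibre of the norm, the preimage of a null point. The fibre may
  contain a second graph, so measurability of the singleton comes separately, as a countable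
  intersection of cylinders.\<close>

lemma countable_null_sets:
  assumes "countable D" "D \<subseteq> graphs V"
  shows "D \<in> null_sets (graph_haar V)"
proof -
  have "{G} \<in> null_sets (graph_haar V)" if "G \<in> graphs V" for G
  proof -
    let ?F = "graph_norm \<psi> -` {graph_norm \<psi> G} \<inter> graphs V"
    have x: "graph_norm \<psi> G \<in> {0..1}"
      using that graph_norm_range by (auto simp: mem_graphs)
    have "{graph_norm \<psi> G} \<in> sets unit_lborel"
      using x by (simp add: sets_restrict_space_iff)
    moreover have "emeasure unit_lborel {graph_norm \<psi> G} = 0"
      using x by (simp add: emeasure_restrict_space)
    ultimately have "?F \<in> null_sets (graph_haar V)"
      using measure_preserving_graph_norm measurable_sets[of "graph_norm \<psi>" "graph_haar V" unit_lborel]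
      by (auto simp: measure_preserving_def null_sets_def graph_haar_eq)
    moreover have "{G} = (\<Inter>n. cylinder n (G \<inter> initial_edges n))"
    proof (intro equalityI subsetI)
      fix H assume H: "H \<in> (\<Inter>n. cylinder n (G \<inter> initial_edges n))"
      have "e \<in> H \<longleftrightarrow> e \<in> G" if "e \<in> edges" for e
      proof -
        have "e \<in> initial_edges (\<psi> e)" using that by (simp add: initial_edges_def)
        moreover have "H \<inter> initial_edges (\<psi> e) = G \<inter> initial_edges (\<psi> e)"
          using H by (auto simp: cylinder_def)
        ultimately show ?thesis by blast
      qed
      moreover have "H \<subseteq> edges" using H by (auto simp: cylinder_def mem_graphs)
      ultimately show "H \<in> {G}" using \<open>G \<in> graphs V\<close> by (auto simp: mem_graphs)
    qed (use that in \<open>auto simp: cylinder_def\<close>)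
    then have "{G} \<in> sets (graph_haar V)"
      using cylinder_sets by (auto simp: graph_haar_eq)
    ultimately show ?thesis
      using that by (auto intro: null_sets_subset)
  qed
  then have "(\<Union>G\<in>D. {G}) \<in> null_sets (graph_haar V)"
    using assms by (intro null_sets_UN') auto
  then show ?thesis by simp
qed

text \<open>Off the countable set of exceptional norms, \<open>x\<close> is the norm of a unique
  non-exceptional graph, which both maps return whichever of the three sets is discarded.\<close>

lemma AE_inverse_graph_norm:
  assumes D: "D \<in> {finite_graphs V, cofinite_graphs V, exceptional}"
  shows "AE x in unit_lborel. digit_graph x = inv_into (graphs V - D) (graph_norm \<psi>) x"
proof -
  have inj: "inj_on (graph_norm \<psi>) (graphs V - D)"
    using D inj_on_graph_norm_finite inj_on_graph_norm_cofinite
    by (auto intro: inj_on_subset[OF inj_on_graph_norm_finite])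
  have "countable (graph_norm \<psi> ` exceptional)"
    using countable_finite_graphs countable_cofinite_graphs by simp
  then have "AE x in lborel. x \<notin> graph_norm \<psi> ` exceptional"
    by (intro AE_not_in countable_imp_null_set_lborel)
  moreover have "digit_graph x = inv_into (graphs V - D) (graph_norm \<psi>) x"
    if x: "x \<in> {0..1}" "x \<notin> graph_norm \<psi> ` exceptional" for x
  proof -
    obtain G where G: "G \<in> graphs V - exceptional" "x = graph_norm \<psi> G"
      using x bij_betw_imp_surj_on[OF bij_betw_graph_norm_exceptional] by blast
    moreover have "G \<in> graphs V - D" using G(1) D by auto
    ultimately show ?thesis
      using inv_into_f_f[OF inj] by (simp add: digit_graph_norm mem_graphs)
  qed
  ultimately show ?thesis
    by (auto simp: AE_restrict_space_iff elim!: eventually_mono)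
qed

end

text \<open>\<open>D\<close> ranges over the three readings of discarding finite and/or co-finite
  graphs. Integrability of the transported functions is asserted too, since
  \<open>ext_integral\<close> has no meaning without it.\<close>

theorem theorem2:
  fixes V :: "'v set" and \<psi> :: "'v set \<Rightarrow> nat"
  assumes "countable V" and "infinite V"
    and "bij_betw \<psi> (complete_edges V) {1..}"
  shows
    "measure_preserving (graph_haar V) (restrict_space lborel {0..1}) (graph_norm \<psi>) \<and>
     measure_preserving (graph_haar V) circle_haar (circle_proj \<circ> graph_norm \<psi>) \<and>
     countable (finite_graphs V) \<and> finite_graphs V \<in> null_sets (graph_haar V) \<and>
     countable (cofinite_graphs V) \<and> cofinite_graphs V \<in> null_sets (graph_haar V) \<and>
     bij_betw (graph_norm \<psi>)
       (graphs V - (finite_graphs V \<union> cofinite_graphs V))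
       ({0..1} - graph_norm \<psi> ` (finite_graphs V \<union> cofinite_graphs V)) \<and>
     bij_betw (circle_proj \<circ> graph_norm \<psi>)
       (graphs V - (finite_graphs V \<union> cofinite_graphs V))
       (topspace circle_topology -
         (circle_proj \<circ> graph_norm \<psi>) ` (finite_graphs V \<union> cofinite_graphs V)) \<and>
     (\<forall>f :: real \<Rightarrow> ereal. ext_integrable (lebesgue_on {0..1}) f \<longrightarrow>
        ext_integrable (completion (graph_haar V)) (\<lambda>G. f (graph_norm \<psi> G)) \<and>
        ext_integral (completion (graph_haar V)) (\<lambda>G. f (graph_norm \<psi> G)) =
          ext_integral (lebesgue_on {0..1}) f) \<and>
     (\<forall>D \<in> {finite_graphs V, cofinite_graphs V, finite_graphs V \<union> cofinite_graphs V}.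
      \<forall>g :: 'v set set \<Rightarrow> ereal. ext_integrable (completion (graph_haar V)) g \<longrightarrow>
        ext_integrable (lebesgue_on {0..1}) (\<lambda>x. g (inv_into (graphs V - D) (graph_norm \<psi>) x)) \<and>
        ext_integral (completion (graph_haar V)) g =
          ext_integral (lebesgue_on {0..1}) (\<lambda>x. g (inv_into (graphs V - D) (graph_norm \<psi>) x)))"
proof -
  interpret edge_enumeration V \<psi> by unfold_locales (rule assms(3))
  have leb: "lebesgue_on {0..1} = completion unit_lborel"
    by (rule completion_restrict_space[symmetric]) simp
  note integral_norm = ext_integral_measure_preserving
      [OF measure_preserving_completion[OF measure_preserving_graph_norm]]
  have integral_inverse:
    "ext_integrable (completion unit_lborel) (\<lambda>x. g (inv_into (graphs V - D) (graph_norm \<psi>) x)) \<and>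
      ext_integral (completion (graph_haar V)) g =
      ext_integral (completion unit_lborel) (\<lambda>x. g (inv_into (graphs V - D) (graph_norm \<psi>) x))"
    if D: "D \<in> {finite_graphs V, cofinite_graphs V, exceptional}"
      and g: "ext_integrable (completion (graph_haar V)) g" for D and g :: "'v set set \<Rightarrow> ereal"
  proof -
    \<comment> \<open>The integral is first carried over by the digit map, which is measurable and
      defined everywhere; only then is it replaced by \<open>inv_into\<close> almost
      everywhere.\<close>
    have digit: "ext_integrable (completion unit_lborel) (\<lambda>x. g (digit_graph x))"
      "ext_integral (completion unit_lborel) (\<lambda>x. g (digit_graph x)) = ext_integral (completion (graph_haar V)) g"
      using ext_integral_measure_preserving
        [OF measure_preserving_completion[OF measure_preserving_digit_graph] g] by simp_all
    have "AE x in completion unit_lborel.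
        g (digit_graph x) = g (inv_into (graphs V - D) (graph_norm \<psi>) x)"
      by (rule AE_completion, rule eventually_mono[OF AE_inverse_graph_norm[OF D]]) simp
    from ext_integral_completion_cong_AE[OF digit(1) this] show ?thesis
      using digit(2) by simp
  qed
  have null: "finite_graphs V \<in> null_sets (graph_haar V)" "cofinite_graphs V \<in> null_sets (graph_haar V)"
    using exceptional_subset countable_finite_graphs countable_cofinite_graphs
    by (auto intro: countable_null_sets)
  show ?thesis
    unfolding leb
    by (intro conjI ballI allI impI measure_preserving_graph_norm measure_preserving_circle_norm
        countable_finite_graphs countable_cofinite_graphs null bij_betw_graph_norm_exceptional
        bij_betw_circle_norm_exceptional)
      (use integral_norm integral_inverse in blast)+
qed

end
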